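(* Let $\alpha\in(0,2)$, $a>0$, and let $\sigma:\mathbb{R}^2\times[0,\infty)\to\mathbb{R}$ be continuous and bounded. Let $U(y,t)$, $y\in\mathbb{R}^2$, $t\ge0$, be the random field defined by the LePage series \[ U(y,t)=C_\alpha\sum_{k\ge1}\Gamma_k^{-1/\alpha}\varphi(\xi_k)^{-1/\alpha}G(y,\xi_k,t)g_k \] (described in the context). Then for all $t\ge0$ and $x\in\mathbb{R}^2$ with $\sigma(x,t)\ne0$ and for all $\delta>0$, \[ \sup_{y\in B(x,\delta)}|U(y,t)|=+\infty\quad\text{almost surely}, \] where $B(x,\delta)=\{y:|y-x|\le\delta\}$.
   Context: Define, for $x,y\in\mathbb{R}^2$, $t\ge0$, \[ G(x,y,t)=\frac{1}{2\pi a}\int_0^{t-\frac{|x-y|}{a}}\frac{\sigma(y,\tau)}{\sqrt{a^2(t-\tau)^2-|y-x|^2}}\,d\tau\;\mathbf{1}_{\{|x-y|<at\}} \] (this may equal $+\infty$, e.g. when $y=x$). LePage construction: let $\varphi$ be a continuous, everywhere positive probability density on $\mathbb{R}^2$; let $\{\Gamma_k\}_{k\ge1}$ be the arrival times of a unit-intensity Poisson process, $\{\xi_k\}_{k\ge1}$ i.i.d. random vectors in $\mathbb{R}^2$ with density $\varphi$, and $\{g_k\}_{k\ge1}$ i.i.d. centered Gaussian variables with $E|g_k|^\alpha=1$, the three families being mutually independent; $C_\alpha=\big(\frac{\Gamma(2-\alpha)\cos(\pi\alpha/2)}{1-\alpha}\big)^{1/\alpha}$ is a positive constant. The S$\alpha$S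 random measure $M(A)=C_\alpha\sum_k\Gamma_k^{-1/\alpha}\varphi(\xi_k)^{-1/\alpha}\mathbf{1}_A(\xi_k)g_k$ is an independently scattered symmetric $\alpha$-stable measure with Lebesgue control measure, and $U(y,t)$ above is the corresponding version of $\iint G(y,z,t)M(dz)$ (for each fixed $(y,t)$ the series converges almost surely).
   Formalization: The claim is proved for t>0 rather than t≥0, since at t=0 the indicator makes G and U(·,0) vanish and the supremum is 0; at α=1, where the formula for C_α reads 0/0, its limit π/2 is used. *)

theory Defs
  imports "HOL-Probability.Probability"
begin

text \<open>The constant C_alpha; at alpha = 1 the formula is read as its limit pi/2.\<close>
definition C_alpha :: "real \<Rightarrow> real" where
  "C_alpha \<alpha> = (if \<alpha> = 1 then pi / 2
     else (Gamma (2 - \<alpha>) * cos (pi * \<alpha> / 2) / (1 - \<alpha>)) powr (1 / \<alpha>))"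

definition G_kernel :: "(real^2 \<Rightarrow> real \<Rightarrow> real) \<Rightarrow> real \<Rightarrow> real^2 \<Rightarrow> real^2 \<Rightarrow> real \<Rightarrow> real \<Rightarrow> real" where
  "G_kernel \<sigma> a x y t \<tau> = \<sigma> y \<tau> / sqrt (a\<^sup>2 * (t - \<tau>)\<^sup>2 - (norm (y - x))\<^sup>2)"

definition G_finite :: "(real^2 \<Rightarrow> real \<Rightarrow> real) \<Rightarrow> real \<Rightarrow> real^2 \<Rightarrow> real^2 \<Rightarrow> real \<Rightarrow> bool" where
  "G_finite \<sigma> a x y t \<longleftrightarrow> \<not> (norm (x - y) < a * t) \<or>
     set_integrable lborel {0..t - norm (x - y) / a} (G_kernel \<sigma> a x y t)"

text \<open>Value of G(x,y,t) (meaningful where G_finite holds).\<close>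
definition G_fun :: "(real^2 \<Rightarrow> real \<Rightarrow> real) \<Rightarrow> real \<Rightarrow> real^2 \<Rightarrow> real^2 \<Rightarrow> real \<Rightarrow> real" where
  "G_fun \<sigma> a x y t = (if norm (x - y) < a * t
     then 1 / (2 * pi * a) * (LINT \<tau>:{0..t - norm (x - y) / a}|lborel. G_kernel \<sigma> a x y t \<tau>)
     else 0)"

text \<open>Poisson arrival times: Gamma_k = E_1 + ... + E_k with i.i.d. Exp(1) interarrival
  times; index k :: nat stands for the (k+1)-th arrival.\<close>
definition arrival :: "(nat \<Rightarrow> 'a \<Rightarrow> real) \<Rightarrow> nat \<Rightarrow> 'a \<Rightarrow> real" where
  "arrival E k \<omega> = (\<Sum>i\<le>k. E i \<omega>)"

definition lepage_term :: "real \<Rightarrow> real \<Rightarrow> (real^2 \<Rightarrow> real \<Rightarrow> real) \<Rightarrow> (real^2 \<Rightarrow> real)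
    \<Rightarrow> (nat \<Rightarrow> 'a \<Rightarrow> real) \<Rightarrow> (nat \<Rightarrow> 'a \<Rightarrow> real^2) \<Rightarrow> (nat \<Rightarrow> 'a \<Rightarrow> real)
    \<Rightarrow> real^2 \<Rightarrow> real \<Rightarrow> 'a \<Rightarrow> nat \<Rightarrow> real" where
  "lepage_term \<alpha> a \<sigma> \<phi> E \<xi> g y t \<omega> k =
     C_alpha \<alpha> * arrival E k \<omega> powr (-1 / \<alpha>) * \<phi> (\<xi> k \<omega>) powr (-1 / \<alpha>)
       * G_fun \<sigma> a y (\<xi> k \<omega>) t * g k \<omega>"

definition U_defined where
  "U_defined \<alpha> a \<sigma> \<phi> E \<xi> g y t \<omega> \<longleftrightarrow>
     (\<forall>k. G_finite \<sigma> a y (\<xi> k \<omega>) t) \<and> summable (lepage_term \<alpha> a \<sigma> \<phi> E \<xi> g y t \<omega>)"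

definition U_field where
  "U_field \<alpha> a \<sigma> \<phi> E \<xi> g y t \<omega> = suminf (lepage_term \<alpha> a \<sigma> \<phi> E \<xi> g y t \<omega>)"

text \<open>Mutual independence of the three families (indep_vars unfolded, since the
  families have different codomains).\<close>
definition lepage_indep :: "'a measure \<Rightarrow> (nat \<Rightarrow> 'a \<Rightarrow> real) \<Rightarrow> (nat \<Rightarrow> 'a \<Rightarrow> real^2)
    \<Rightarrow> (nat \<Rightarrow> 'a \<Rightarrow> real) \<Rightarrow> bool" where
  "lepage_indep M E \<xi> g \<longleftrightarrow> prob_space.indep_sets M
     (\<lambda>i. case i of
        Inl n \<Rightarrow> {E n -` A \<inter> space M | A. A \<in> sets borel}
      | Inr (Inl n) \<Rightarrow> {\<xi> n -` A \<inter> space M | A. A \<in> sets borel}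
      | Inr (Inr n) \<Rightarrow> {g n -` A \<inter> space M | A. A \<in> sets borel})
     (UNIV :: (nat + nat + nat) set)"

end

theory Submission
  imports Defs "HOL-Real_Asymp.Real_Asymp"
begin

text \<open>
  For fixed \<open>y\<close>, the kernel \<open>G(y, z, t)\<close> is at most a multiple of \<open>arcosh (at / |y - z|)\<close> and
  vanishes for \<open>|y - z| \<ge> at\<close>, so \<open>\<phi>(\<xi>) powr (-1/\<alpha>) * G(y, \<xi>, t)\<close> is square integrable. As the
  arrival times grow linearly and \<open>2/\<alpha> > 1\<close>, the series defining \<open>U(y, t)\<close> is, up to finitely many
  terms, a series of martingale differences with summable variances. Hence it converges almost
  surely, and almost surely it converges at all points of a countable dense set \<open>D\<close>.

  Almost surely some \<open>\<xi>\<^sub>k\<close> lies so close to \<open>x\<close> that \<open>\<sigma>(\<xi>\<^sub>k, t) \<noteq> 0\<close>, and then \<open>G(y, \<xi>\<^sub>k, t)\<close> has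
  a logarithmic singularity at \<open>y = \<xi>\<^sub>k\<close>. Write \<open>U(y, t) = T(y) g\<^sub>k + R(y)\<close> on \<open>D\<close>, where neither
  \<open>T\<close> nor \<open>R\<close> involves \<open>g\<^sub>k\<close>. As \<open>T\<close> is unbounded on \<open>D\<close> near \<open>x\<close>, there is at most one real \<open>u\<close>
  for which \<open>u T + R\<close> is bounded there, and by Fubini's theorem the atomless \<open>g\<^sub>k\<close> avoids it almost
  surely.
\<close>

section \<open>Almost sure convergence of square integrable martingales\<close>

lemma (in prob_space) AE_if_prob_le_tendsto_0:
  assumes "{\<omega> \<in> space M. \<not> P \<omega>} \<in> events"
    and "\<And>n. prob {\<omega> \<in> space M. \<not> P \<omega>} \<le> u n" and "u \<longlonglongrightarrow> 0"
  shows "AE \<omega> in M. P \<omega>"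
proof -
  have "prob {\<omega> \<in> space M. \<not> P \<omega>} \<le> 0"
    using assms(2) by (intro LIMSEQ_le_const[OF assms(3)]) blast
  then have "prob {\<omega> \<in> space M. \<not> P \<omega>} = 0"
    by (simp add: measure_le_0_iff)
  then show ?thesis
    using prob_Collect_eq_0[OF assms(1)] by simp
qed

lemma integrable_mult_bounded:
  fixes f Z :: "'a \<Rightarrow> real"
  assumes "integrable M f" and [measurable]: "Z \<in> borel_measurable M"
    and bounded: "\<And>\<omega>. \<bar>Z \<omega>\<bar> \<le> b"
  shows "integrable M (\<lambda>\<omega>. f \<omega> * Z \<omega>)"
proof (rule Bochner_Integration.integrable_bound)
  show "integrable M (\<lambda>\<omega>. f \<omega> * b)"
    using assms(1) by simp
  show "AE \<omega> in M. norm (f \<omega> * Z \<omega>) \<le> norm (f \<omega> * b)"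
    using mult_left_mono[OF order_trans[OF bounded abs_ge_self] abs_ge_zero]
    by (intro AE_I2) (simp add: abs_mult)
qed (use assms(1) in measurable)

text \<open>The \<open>F n\<close> need not be increasing: only \<open>X 0, \<dots>, X (n - 1)\<close> have to be measurable for \<open>F n\<close>.\<close>
locale square_integrable_martingale_differences = prob_space M for M :: "'a measure" +
  fixes F :: "nat \<Rightarrow> 'a measure" and X :: "nat \<Rightarrow> 'a \<Rightarrow> real"
  assumes subalgebra_F: "\<And>n. subalgebra M (F n)"
    and adapted: "\<And>i n. i < n \<Longrightarrow> X i \<in> borel_measurable (F n)"
    and random_variable_X [measurable]: "\<And>n. X n \<in> borel_measurable M"
    and integrable_X_square: "\<And>n. integrable M (\<lambda>\<omega>. (X n \<omega>)\<^sup>2)"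
    and orthogonal: "\<And>n Z b. Z \<in> borel_measurable (F n) \<Longrightarrow> (\<And>\<omega>. \<bar>Z \<omega>\<bar> \<le> b)
      \<Longrightarrow> expectation (\<lambda>\<omega>. X n \<omega> * Z \<omega>) = 0"
begin

primrec stopped_sum :: "real \<Rightarrow> nat \<Rightarrow> 'a \<Rightarrow> real" where
  "stopped_sum \<epsilon> 0 = (\<lambda>_. 0)"
| "stopped_sum \<epsilon> (Suc n) = (\<lambda>\<omega>. stopped_sum \<epsilon> n \<omega> +
     (if \<bar>stopped_sum \<epsilon> n \<omega>\<bar> < \<epsilon> then X n \<omega> else 0))"

lemma stopped_sum_measurable:
  assumes "\<And>i. i < n \<Longrightarrow> X i \<in> borel_measurable N"
  shows "stopped_sum \<epsilon> n \<in> borel_measurable N"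
  using assms
proof (induction n)
  case (Suc n)
  then have [measurable]: "stopped_sum \<epsilon> n \<in> borel_measurable N" "X n \<in> borel_measurable N"
    by auto
  show ?case by simp
qed simp

lemma abs_stopped_sum_ge:
  assumes "0 < \<epsilon>" and "k \<le> n" and "\<epsilon> \<le> \<bar>\<Sum>i<k. X i \<omega>\<bar>"
  shows "\<epsilon> \<le> \<bar>stopped_sum \<epsilon> n \<omega>\<bar>"
proof -
  have "stopped_sum \<epsilon> n \<omega> = (\<Sum>i<n. X i \<omega>) \<and> (\<forall>k\<le>n. \<bar>\<Sum>i<k. X i \<omega>\<bar> < \<epsilon>)
      \<or> \<epsilon> \<le> \<bar>stopped_sum \<epsilon> n \<omega>\<bar>"
    using assms(1) by (induction n) (auto simp: le_Suc_eq not_less)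
  then show ?thesis using assms(2,3) by (auto simp: not_less[symmetric])
qed

lemma stopped_sum_second_moment:
  "integrable M (\<lambda>\<omega>. (stopped_sum \<epsilon> n \<omega>)\<^sup>2) \<and>
   expectation (\<lambda>\<omega>. (stopped_sum \<epsilon> n \<omega>)\<^sup>2) \<le> (\<Sum>i<n. expectation (\<lambda>\<omega>. (X i \<omega>)\<^sup>2))"
proof (induction n)
  case (Suc n)
  let ?S = "stopped_sum \<epsilon> n"
  let ?I = "indicator {\<omega>. \<bar>?S \<omega>\<bar> < \<epsilon>} :: 'a \<Rightarrow> real"
  have S_F [measurable]: "?S \<in> borel_measurable (F n)"
    using adapted by (rule stopped_sum_measurable)
  have [measurable]: "?S \<in> borel_measurable M"
    by (rule measurable_from_subalg[OF subalgebra_F S_F])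
  have SI_bounded: "\<bar>?S \<omega> * ?I \<omega>\<bar> \<le> \<bar>\<epsilon>\<bar>" for \<omega>
    by (auto split: split_indicator)
  have cross: "expectation (\<lambda>\<omega>. X n \<omega> * (?S \<omega> * ?I \<omega>)) = 0"
    by (rule orthogonal[OF _ SI_bounded]) (unfold indicator_def mem_Collect_eq, measurable)
  have integrable_cross: "integrable M (\<lambda>\<omega>. X n \<omega> * (?S \<omega> * ?I \<omega>))"
    by (rule integrable_mult_bounded[OF square_integrable_imp_integrable[OF
          random_variable_X integrable_X_square] _ SI_bounded])
      (unfold indicator_def mem_Collect_eq, measurable)
  have integrable_last: "integrable M (\<lambda>\<omega>. (X n \<omega>)\<^sup>2 * ?I \<omega>)"
    by (rule Bochner_Integration.integrable_bound[OF integrable_X_square[of n]])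
      (auto simp: indicator_def)
  have last_le: "expectation (\<lambda>\<omega>. (X n \<omega>)\<^sup>2 * ?I \<omega>) \<le> expectation (\<lambda>\<omega>. (X n \<omega>)\<^sup>2)"
    by (intro integral_mono integrable_last integrable_X_square) (auto split: split_indicator)
  have expand: "(stopped_sum \<epsilon> (Suc n) \<omega>)\<^sup>2 =
      (?S \<omega>)\<^sup>2 + 2 * (X n \<omega> * (?S \<omega> * ?I \<omega>)) + (X n \<omega>)\<^sup>2 * ?I \<omega>" for \<omega>
    by (simp add: power2_eq_square algebra_simps split: split_indicator)
  show ?case
    unfolding expand using Suc.IH integrable_cross integrable_last cross last_le by simp
qed simp

text \<open>Stopping keeps the increments orthogonal, so Chebyshev's inequality for the stopped sum
  controls the maximum of the partial sums.\<close>
lemma Kolmogorov_maximal_inequality: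
  assumes "0 < \<epsilon>"
  shows "prob {\<omega> \<in> space M. \<exists>k\<le>n. \<epsilon> \<le> \<bar>\<Sum>i<k. X i \<omega>\<bar>}
    \<le> (\<Sum>i<n. expectation (\<lambda>\<omega>. (X i \<omega>)\<^sup>2)) / \<epsilon>\<^sup>2"
proof -
  let ?S = "stopped_sum \<epsilon> n"
  have [measurable]: "?S \<in> borel_measurable M"
    by (rule stopped_sum_measurable) measurable
  have "\<epsilon>\<^sup>2 \<le> (?S \<omega>)\<^sup>2" if "k \<le> n" "\<epsilon> \<le> \<bar>\<Sum>i<k. X i \<omega>\<bar>" for k \<omega>
    using power_mono[OF abs_stopped_sum_ge[OF assms that], of 2] assms by simp
  then have "prob {\<omega> \<in> space M. \<exists>k\<le>n. \<epsilon> \<le> \<bar>\<Sum>i<k. X i \<omega>\<bar>} \<le> prob {\<omega> \<in> space M. \<epsilon>\<^sup>2 \<le> (?S \<omega>)\<^sup>2}"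
    by (intro finite_measure_mono) auto
  also have "\<dots> \<le> expectation (\<lambda>\<omega>. (?S \<omega>)\<^sup>2) / \<epsilon>\<^sup>2"
    by (rule integral_Markov_inequality_measure[where A="{}"])
      (use stopped_sum_second_moment assms in auto)
  also have "\<dots> \<le> (\<Sum>i<n. expectation (\<lambda>\<omega>. (X i \<omega>)\<^sup>2)) / \<epsilon>\<^sup>2"
    using stopped_sum_second_moment by (intro divide_right_mono) auto
  finally show ?thesis .
qed

lemma square_integrable_martingale_differences_shift:
  "square_integrable_martingale_differences M (\<lambda>i. F (i + m)) (\<lambda>i. X (i + m))"
  by unfold_locales (use subalgebra_F adapted integrable_X_square in \<open>auto intro: orthogonal\<close>)

lemma prob_tail_sums_ge:
  assumes "summable (\<lambda>n. expectation (\<lambda>\<omega>. (X n \<omega>)\<^sup>2))" and "0 < \<epsilon>"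
  shows "prob {\<omega> \<in> space M. \<exists>k. \<epsilon> \<le> \<bar>\<Sum>i<k. X (i + m) \<omega>\<bar>}
    \<le> (\<Sum>i. expectation (\<lambda>\<omega>. (X (i + m) \<omega>)\<^sup>2)) / \<epsilon>\<^sup>2"
proof (rule LIMSEQ_le_const2)
  interpret shifted: square_integrable_martingale_differences M "\<lambda>i. F (i + m)" "\<lambda>i. X (i + m)"
    by (rule square_integrable_martingale_differences_shift)
  let ?B = "\<lambda>n. {\<omega> \<in> space M. \<exists>k\<le>n. \<epsilon> \<le> \<bar>\<Sum>i<k. X (i + m) \<omega>\<bar>}"
  have "(\<lambda>n. prob (?B n)) \<longlonglongrightarrow> prob (\<Union>n. ?B n)"
    by (rule finite_Lim_measure_incseq) (auto simp: incseq_def intro: order_trans)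
  also have "(\<Union>n. ?B n) = {\<omega> \<in> space M. \<exists>k. \<epsilon> \<le> \<bar>\<Sum>i<k. X (i + m) \<omega>\<bar>}"
    by auto
  finally show "(\<lambda>n. prob (?B n)) \<longlonglongrightarrow> prob {\<omega> \<in> space M. \<exists>k. \<epsilon> \<le> \<bar>\<Sum>i<k. X (i + m) \<omega>\<bar>}" .
  have "prob (?B n) \<le> (\<Sum>i. expectation (\<lambda>\<omega>. (X (i + m) \<omega>)\<^sup>2)) / \<epsilon>\<^sup>2" for n
    using assms summable_ignore_initial_segment[OF assms(1), of m]
    by (intro order_trans[OF shifted.Kolmogorov_maximal_inequality] divide_right_mono
        sum_le_suminf) auto
  then show "\<exists>N. \<forall>n\<ge>N. prob (?B n) \<le> (\<Sum>i. expectation (\<lambda>\<omega>. (X (i + m) \<omega>)\<^sup>2)) / \<epsilon>\<^sup>2"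
    by blast
qed

end

lemma summable_if_tail_sums_small:
  fixes f :: "nat \<Rightarrow> 'b::banach"
  assumes "\<And>e. 0 < e \<Longrightarrow> \<exists>m. \<forall>k. norm (\<Sum>i<k. f (i + m)) < e"
  shows "summable f"
  unfolding summable_Cauchy
proof (intro allI impI)
  fix e :: real assume "0 < e"
  then obtain m where m: "\<And>k. norm (\<Sum>i<k. f (i + m)) < e / 2"
    using assms[of "e / 2"] by auto
  have "norm (sum f {p..<q}) < e" if "m \<le> p" for p q
  proof (cases "p \<le> q")
    case True
    have tail: "sum f {m..<n} = (\<Sum>i<n - m. f (i + m))" for n
      using sum.shift_bounds_nat_ivl[of f 0 m "n - m"]
      by (cases "m \<le> n") (auto simp: atLeast0LessThan)
    have "sum f {p..<q} = sum f {m..<q} - sum f {m..<p}"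
      using sum.atLeastLessThan_concat[OF that True, of f] by (simp add: algebra_simps)
    then show ?thesis
      using norm_triangle_ineq4[of "sum f {m..<q}" "sum f {m..<p}"] m[of "q - m"] m[of "p - m"]
      unfolding tail by simp
  qed (use \<open>0 < e\<close> in simp)
  then show "\<exists>N. \<forall>p\<ge>N. \<forall>q. norm (sum f {p..<q}) < e" by blast
qed

theorem (in square_integrable_martingale_differences) AE_summable:
  assumes summable: "summable (\<lambda>n. expectation (\<lambda>\<omega>. (X n \<omega>)\<^sup>2))"
  shows "AE \<omega> in M. summable (\<lambda>n. X n \<omega>)"
proof -
  let ?V = "\<lambda>m. \<Sum>i. expectation (\<lambda>\<omega>. (X (i + m) \<omega>)\<^sup>2)"
  have small_tail: "AE \<omega> in M. \<exists>m. \<forall>k. \<bar>\<Sum>i<k. X (i + m) \<omega>\<bar> < \<epsilon>" if "0 < \<epsilon>" for \<epsilon>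
  proof (rule AE_if_prob_le_tendsto_0)
    show "{\<omega> \<in> space M. \<not> (\<exists>m. \<forall>k. \<bar>\<Sum>i<k. X (i + m) \<omega>\<bar> < \<epsilon>)} \<in> events"
      by measurable
    show "prob {\<omega> \<in> space M. \<not> (\<exists>m. \<forall>k. \<bar>\<Sum>i<k. X (i + m) \<omega>\<bar> < \<epsilon>)} \<le> ?V m / \<epsilon>\<^sup>2" for m
      by (rule order_trans[OF finite_measure_mono prob_tail_sums_ge[OF summable that]])
        (auto simp: not_less)
    show "(\<lambda>m. ?V m / \<epsilon>\<^sup>2) \<longlonglongrightarrow> 0"
      by (intro tendsto_divide_zero suminf_exist_split2 summable)
  qed
  have "AE \<omega> in M. \<forall>j. \<exists>m. \<forall>k. \<bar>\<Sum>i<k. X (i + m) \<omega>\<bar> < inverse (real (Suc j))"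
    by (subst AE_all_countable) (intro allI small_tail, simp)
  then show ?thesis
  proof eventually_elim
    case (elim \<omega>)
    show ?case
    proof (rule summable_if_tail_sums_small)
      fix e :: real assume "0 < e"
      then obtain j where "inverse (real (Suc j)) < e"
        using reals_Archimedean by blast
      then show "\<exists>m. \<forall>k. norm (\<Sum>i<k. X (i + m) \<omega>) < e"
        using elim unfolding real_norm_def by (meson less_trans)
    qed
  qed
qed

section \<open>Random variables independent of a subalgebra\<close>

lemma Int_stable_vimage_sets: "Int_stable {X -` A \<inter> S | A. A \<in> sets N}"
proof (rule Int_stableI, clarify)
  fix A B assume "A \<in> sets N" "B \<in> sets N"
  then show "\<exists>C. X -` A \<inter> S \<inter> (X -` B \<inter> S) = X -` C \<inter> S \<and> C \<in> sets N"
    by (intro exI[of _ "A \<inter> B"]) auto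
qed

context prob_space
begin

definition indep_of_subalgebra :: "'a measure \<Rightarrow> 'b measure \<Rightarrow> ('a \<Rightarrow> 'b) \<Rightarrow> bool" where
  "indep_of_subalgebra F N X \<longleftrightarrow> subalgebra M F \<and> random_variable N X \<and>
     indep_set (sets F) {X -` A \<inter> space M | A. A \<in> sets N}"

lemma indep_of_subalgebraD:
  assumes "indep_of_subalgebra F N X"
  shows "subalgebra M F" and "random_variable N X"
    and "\<And>A B. A \<in> sets F \<Longrightarrow> B \<in> sets N \<Longrightarrow>
      prob (A \<inter> (X -` B \<inter> space M)) = prob A * prob (X -` B \<inter> space M)"
  using assms by (auto simp: indep_of_subalgebra_def intro!: indep_setD)

lemma indep_var_if_indep_of_subalgebra:
  assumes indep: "indep_of_subalgebra F N X" and Y [measurable]: "Y \<in> measurable F L"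
  shows "indep_var L Y N X"
  unfolding indep_var_eq
proof (intro conjI indep_set_sigma_sets Int_stable_vimage_sets indep_of_subalgebraD(2)[OF indep]
    measurable_from_subalg[OF indep_of_subalgebraD(1)[OF indep] Y])
  have "Y -` A \<inter> space M \<in> sets F" if "A \<in> sets L" for A
    using measurable_sets[OF Y that] indep_of_subalgebraD(1)[OF indep]
    by (simp add: subalgebra_def)
  then show "indep_set {Y -` A \<inter> space M | A. A \<in> sets L} {X -` A \<inter> space M | A. A \<in> sets N}"
    using indep unfolding indep_of_subalgebra_def indep_sets2_eq by blast
qed

lemma expectation_mult_indep_of_subalgebra:
  fixes X Y :: "'a \<Rightarrow> real"
  assumes "indep_of_subalgebra F borel X" and "Y \<in> borel_measurable F"
    and "integrable M Y" "integrable M X"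
  shows "integrable M (\<lambda>\<omega>. Y \<omega> * X \<omega>)"
    and "expectation (\<lambda>\<omega>. Y \<omega> * X \<omega>) = expectation Y * expectation X"
  using indep_var_integrable[OF indep_var_if_indep_of_subalgebra[OF assms(1,2)] assms(3,4)]
    indep_var_lebesgue_integral[OF indep_var_if_indep_of_subalgebra[OF assms(1,2)] assms(3,4)]
  by simp_all

lemma indep_of_subalgebra_compose:
  assumes indep: "indep_of_subalgebra F N X" and h: "h \<in> measurable N L"
  shows "indep_of_subalgebra F L (\<lambda>\<omega>. h (X \<omega>))"
proof -
  note X = indep_of_subalgebraD(2)[OF indep]
  have "{(\<lambda>\<omega>. h (X \<omega>)) -` A \<inter> space M | A. A \<in> sets L} \<subseteq> {X -` A \<inter> space M | A. A \<in> sets N}"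
  proof clarify
    fix A assume "A \<in> sets L"
    then show "\<exists>B. (\<lambda>\<omega>. h (X \<omega>)) -` A \<inter> space M = X -` B \<inter> space M \<and> B \<in> sets N"
      using measurable_space[OF X] measurable_sets[OF h]
      by (intro exI[of _ "h -` A \<inter> space N"]) auto
  qed
  then have "indep_set (sets F) {(\<lambda>\<omega>. h (X \<omega>)) -` A \<inter> space M | A. A \<in> sets L}"
    using indep unfolding indep_of_subalgebra_def indep_sets2_eq
    by (meson order_trans subsetD)
  then show ?thesis
    using indep_of_subalgebraD(1)[OF indep] measurable_compose[OF X h]
    by (simp add: indep_of_subalgebra_def)
qed

lemma distr_Pair_indep_of_subalgebra:
  assumes "indep_of_subalgebra F N X"
  shows "restr_to_subalg M F \<Otimes>\<^sub>M distr M N X = distr M (F \<Otimes>\<^sub>M N) (\<lambda>\<omega>. (\<omega>, X \<omega>))"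
proof (rule pair_measure_eqI)
  note F = indep_of_subalgebraD(1)[OF assms] and X [measurable] = indep_of_subalgebraD(2)[OF assms]
  have [measurable]: "(\<lambda>\<omega>. \<omega>) \<in> measurable M F"
    by (rule measurable_from_subalg[OF F]) simp
  interpret restr: prob_space "restr_to_subalg M F"
    by (rule prob_space_restr_to_subalg[OF F]) unfold_locales
  interpret distr: prob_space "distr M N X" by (rule prob_space_distr[OF X])
  show "sigma_finite_measure (restr_to_subalg M F)" "sigma_finite_measure (distr M N X)" ..
  show "sets (restr_to_subalg M F \<Otimes>\<^sub>M distr M N X) = sets (distr M (F \<Otimes>\<^sub>M N) (\<lambda>\<omega>. (\<omega>, X \<omega>)))"
    by (simp add: sets_restr_to_subalg[OF F] cong: sets_pair_measure_cong)
  fix A B assume "A \<in> sets (restr_to_subalg M F)" and "B \<in> sets (distr M N X)"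
  then have A: "A \<in> sets F" and B: "B \<in> sets N"
    by (simp_all add: sets_restr_to_subalg[OF F])
  have "emeasure (restr_to_subalg M F) A * emeasure (distr M N X) B =
      emeasure M (A \<inter> (X -` B \<inter> space M))"
    using A B by (simp add: emeasure_restr_to_subalg[OF F] emeasure_distr emeasure_eq_measure
        indep_of_subalgebraD(3)[OF assms] ennreal_mult)
  also have "A \<inter> (X -` B \<inter> space M) = (\<lambda>\<omega>. (\<omega>, X \<omega>)) -` (A \<times> B) \<inter> space M"
    by auto
  also have "emeasure M \<dots> = emeasure (distr M (F \<Otimes>\<^sub>M N) (\<lambda>\<omega>. (\<omega>, X \<omega>))) (A \<times> B)"
    using A B by (intro emeasure_distr[symmetric]) auto
  finally show "emeasure (restr_to_subalg M F) A * emeasure (distr M N X) B =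
    emeasure (distr M (F \<Otimes>\<^sub>M N) (\<lambda>\<omega>. (\<omega>, X \<omega>))) (A \<times> B)" .
qed

lemma AE_freezing:
  assumes indep: "indep_of_subalgebra F N X"
    and P [measurable]: "Measurable.pred (F \<Otimes>\<^sub>M N) (\<lambda>(\<omega>, x). P \<omega> x)"
    and frozen: "\<And>\<omega>. \<omega> \<in> space M \<Longrightarrow> AE \<omega>' in M. P \<omega> (X \<omega>')"
  shows "AE \<omega> in M. P \<omega> (X \<omega>)"
proof -
  note F = indep_of_subalgebraD(1)[OF indep] and X [measurable] = indep_of_subalgebraD(2)[OF indep]
  have [measurable]: "(\<lambda>\<omega>. \<omega>) \<in> measurable M F"
    by (rule measurable_from_subalg[OF F]) simp
  have [measurable]: "{x \<in> space N. P \<omega> x} \<in> sets N" if "\<omega> \<in> space M" for \<omega>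
    using measurable_compose[OF measurable_Pair1' P, of \<omega>] that F
    by (simp add: pred_def subalgebra_def)
  interpret restr: prob_space "restr_to_subalg M F"
    by (rule prob_space_restr_to_subalg[OF F]) unfold_locales
  interpret distr: prob_space "distr M N X" by (rule prob_space_distr[OF X])
  interpret pair: pair_sigma_finite "restr_to_subalg M F" "distr M N X" ..
  have "AE p in restr_to_subalg M F \<Otimes>\<^sub>M distr M N X. case p of (\<omega>, x) \<Rightarrow> P \<omega> x"
  proof (rule pair.AE_pair_measure)
    have "sets (restr_to_subalg M F \<Otimes>\<^sub>M distr M N X) = sets (F \<Otimes>\<^sub>M N)"
      by (simp add: sets_restr_to_subalg[OF F] cong: sets_pair_measure_cong)
    then show "{p \<in> space (restr_to_subalg M F \<Otimes>\<^sub>M distr M N X). case p of (\<omega>, x) \<Rightarrow> P \<omega> x}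
        \<in> sets (restr_to_subalg M F \<Otimes>\<^sub>M distr M N X)"
      using P by (simp add: pred_def cong: sets_eq_imp_space_eq)
    show "AE \<omega> in restr_to_subalg M F. AE x in distr M N X. case (\<omega>, x) of (\<omega>, x) \<Rightarrow> P \<omega> x"
      by (rule AE_I2) (simp add: space_restr_to_subalg AE_distr_iff frozen)
  qed
  then show ?thesis
    unfolding distr_Pair_indep_of_subalgebra[OF indep] by (simp add: AE_distr_iff)
qed

lemma indep_set_sigma_sets_Union:
  assumes indep: "indep_sets G I" and Int_stable: "\<And>i. i \<in> I \<Longrightarrow> Int_stable (G i)"
    and "J \<subseteq> I" "K \<subseteq> I" "J \<inter> K = {}"
  shows "indep_set (sigma_sets (space M) (\<Union>j\<in>J. G j)) (sigma_sets (space M) (\<Union>k\<in>K. G k))"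
proof -
  have "indep_sets (\<lambda>b. sigma_sets (space M) (\<Union>i\<in>case_bool J K b. G i)) UNIV"
  proof (rule indep_sets_collect_sigma)
    show "indep_sets G (\<Union>b. case_bool J K b)"
      by (rule indep_sets_mono_index[OF _ indep]) (use assms(3,4) in \<open>auto split: bool.splits\<close>)
    show "Int_stable (G i)" if "i \<in> case_bool J K b" for b i
      using that assms(3,4) by (intro Int_stable) (auto split: bool.splits)
    show "disjoint_family_on (case_bool J K) UNIV"
      using assms(5) by (auto simp: disjoint_family_on_def split: bool.splits)
  qed
  then show ?thesis
    unfolding indep_set_def by (rule back_subst[of "\<lambda>H. indep_sets H UNIV"])
      (auto simp: fun_eq_iff split: bool.split)
qed

lemma indep_sets_reindex:
  assumes "indep_sets G UNIV" "inj f"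
  shows "indep_sets (\<lambda>i. G (f i)) UNIV"
proof (rule indep_setsI)
  show "G (f i) \<subseteq> events" for i
    using assms(1) by (auto simp: indep_sets_def)
  fix A J assume J: "J \<noteq> {}" "finite J" "\<forall>j\<in>J. A j \<in> G (f j)"
  have "prob (\<Inter>i\<in>f ` J. A (inv f i)) = (\<Prod>i\<in>f ` J. prob (A (inv f i)))"
    by (rule indep_setsD[OF assms(1)]) (use J assms(2) in auto)
  then show "prob (\<Inter>j\<in>J. A j) = (\<Prod>j\<in>J. prob (A j))"
    using assms(2) by (simp add: prod.reindex inj_on_subset[OF assms(2)])
qed

lemma AE_ex_in_if_indep_vars:
  fixes X :: "nat \<Rightarrow> 'a \<Rightarrow> 'b"
  assumes indep: "indep_vars (\<lambda>_. N) X UNIV" and S: "S \<in> sets N"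
    and "0 < p" "\<And>k. p \<le> prob (X k -` S \<inter> space M)"
  shows "AE \<omega> in M. \<exists>k. X k \<omega> \<in> S"
proof (rule AE_if_prob_le_tendsto_0)
  have X [measurable]: "random_variable N (X k)" for k
    using indep by (auto simp: indep_vars_def)
  note S [measurable]
  show "{\<omega> \<in> space M. \<not> (\<exists>k. X k \<omega> \<in> S)} \<in> events" by measurable
  show "prob {\<omega> \<in> space M. \<not> (\<exists>k. X k \<omega> \<in> S)} \<le> (1 - p) ^ Suc n" for n
  proof -
    let ?miss = "\<lambda>k. X k -` (space N - S) \<inter> space M"
    have "?miss k = space M - (X k -` S \<inter> space M)" for k
      using measurable_space[OF X] by auto
    then have "prob (?miss k) \<le> 1 - p" for k
      using assms(4)[of k] measurable_sets[OF X S, of k] by (simp add: prob_compl)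
    then have "(\<Prod>k\<le>n. prob (?miss k)) \<le> (\<Prod>k\<le>n. 1 - p)"
      by (intro prod_mono) auto
    moreover have "prob (\<Inter>k\<in>{..n}. ?miss k) = (\<Prod>k\<le>n. prob (?miss k))"
      by (rule indep_varsD[OF indep]) auto
    moreover have "prob {\<omega> \<in> space M. \<not> (\<exists>k. X k \<omega> \<in> S)} \<le> prob (\<Inter>k\<in>{..n}. ?miss k)"
      using measurable_space[OF X] by (intro finite_measure_mono) auto
    ultimately show ?thesis by simp
  qed
  have "p \<le> 1" using assms(4)[of 0] prob_le_1 order_trans by blast
  then show "(\<lambda>n. (1 - p) ^ Suc n) \<longlonglongrightarrow> 0"
    using assms(3) by (intro LIMSEQ_Suc LIMSEQ_power_zero) auto
qed

end

lemma (in prob_space) expectation_centred_indep_times_bounded_eq_0: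
  fixes X Y Z :: "'a \<Rightarrow> real"
  assumes indep: "indep_of_subalgebra F borel X" and X: "integrable M X" "expectation X = 0"
    and Y: "Y \<in> borel_measurable F" "integrable M Y"
    and Z: "Z \<in> borel_measurable F" "\<And>\<omega>. \<bar>Z \<omega>\<bar> \<le> b"
  shows "expectation (\<lambda>\<omega>. Y \<omega> * X \<omega> * Z \<omega>) = 0"
proof -
  have "random_variable borel Z"
    by (rule measurable_from_subalg[OF indep_of_subalgebraD(1)[OF indep] Z(1)])
  then have "integrable M (\<lambda>\<omega>. Y \<omega> * Z \<omega>)"
    by (rule integrable_mult_bounded[OF Y(2) _ Z(2)])
  then have "expectation (\<lambda>\<omega>. (Y \<omega> * Z \<omega>) * X \<omega>) = 0"
    using X expectation_mult_indep_of_subalgebra(2)[OF indep borel_measurable_times[OF Y(1) Z(1)]]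
    by simp
  then show ?thesis
    by (simp add: mult_ac)
qed

lemma (in prob_space) AE_summable_martingale_transform:
  fixes A g :: "nat \<Rightarrow> 'a \<Rightarrow> real"
  assumes indep: "\<And>n. indep_of_subalgebra (F n) borel (g n)"
    and predictable: "\<And>n. A n \<in> borel_measurable (F n)"
    and adapted: "\<And>i n. i < n \<Longrightarrow> (\<lambda>\<omega>. A i \<omega> * g i \<omega>) \<in> borel_measurable (F n)"
    and A_square: "\<And>n. integrable M (\<lambda>\<omega>. (A n \<omega>)\<^sup>2)"
    and g_square: "\<And>n. integrable M (\<lambda>\<omega>. (g n \<omega>)\<^sup>2)"
    and g_centred: "\<And>n. expectation (g n) = 0"
    and g_second_moment: "\<And>n. expectation (\<lambda>\<omega>. (g n \<omega>)\<^sup>2) \<le> v"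
    and summable: "summable (\<lambda>n. expectation (\<lambda>\<omega>. (A n \<omega>)\<^sup>2))"
  shows "AE \<omega> in M. summable (\<lambda>n. A n \<omega> * g n \<omega>)"
proof -
  let ?X = "\<lambda>n \<omega>. A n \<omega> * g n \<omega>"
  note F = indep_of_subalgebraD(1)[OF indep]
  have A [measurable]: "random_variable borel (A n)" for n
    by (rule measurable_from_subalg[OF F predictable])
  have g [measurable]: "random_variable borel (g n)" for n
    by (rule indep_of_subalgebraD(2)[OF indep])
  have g_square_indep: "indep_of_subalgebra (F n) borel (\<lambda>\<omega>. (g n \<omega>)\<^sup>2)" for n
    by (rule indep_of_subalgebra_compose[OF indep, where h="\<lambda>x. x\<^sup>2"]) measurable
  have "(\<lambda>\<omega>. (A n \<omega>)\<^sup>2) \<in> borel_measurable (F n)" for n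
    using predictable[of n] by measurable
  then have X_square: "integrable M (\<lambda>\<omega>. (?X n \<omega>)\<^sup>2)"
    "expectation (\<lambda>\<omega>. (?X n \<omega>)\<^sup>2) = expectation (\<lambda>\<omega>. (A n \<omega>)\<^sup>2) * expectation (\<lambda>\<omega>. (g n \<omega>)\<^sup>2)" for n
    unfolding power_mult_distrib
    by (rule expectation_mult_indep_of_subalgebra[OF g_square_indep _ A_square g_square])+
  interpret square_integrable_martingale_differences M F ?X
  proof
    show "subalgebra M (F n)" for n by (rule F)
    show "?X i \<in> borel_measurable (F n)" if "i < n" for i n using that by (rule adapted)
    show "?X n \<in> borel_measurable M" for n by measurable
    show "integrable M (\<lambda>\<omega>. (?X n \<omega>)\<^sup>2)" for n by (rule X_square(1))
    show "expectation (\<lambda>\<omega>. ?X n \<omega> * Z \<omega>) = 0"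
      if "Z \<in> borel_measurable (F n)" "\<And>\<omega>. \<bar>Z \<omega>\<bar> \<le> b" for n b Z
      using that square_integrable_imp_integrable[OF A A_square]
        square_integrable_imp_integrable[OF g g_square]
      by (intro expectation_centred_indep_times_bounded_eq_0[OF indep _ g_centred predictable])
  qed
  show ?thesis
  proof (rule AE_summable, rule summable_comparison_test')
    show "summable (\<lambda>n. expectation (\<lambda>\<omega>. (A n \<omega>)\<^sup>2) * v)"
      by (intro summable_mult2 summable)
    show "norm (expectation (\<lambda>\<omega>. (?X n \<omega>)\<^sup>2)) \<le> expectation (\<lambda>\<omega>. (A n \<omega>)\<^sup>2) * v" for n
      using X_square(2)[of n] g_second_moment[of n]
      by (auto simp: abs_mult intro!: mult_left_mono)
  qed
qed

section \<open>Random variables with a density\<close>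

lemma (in prob_space) AE_neq_if_distributed_lborel:
  fixes X :: "'a \<Rightarrow> 'b::euclidean_space"
  assumes "distributed M lborel X f"
  shows "AE \<omega> in M. X \<omega> \<noteq> u"
  using AE_lborel_singleton[of u] by (subst distributed_AE2[OF assms]) auto

lemma (in prob_space) centred_normal_second_moment:
  assumes X: "distributed M lborel X (normal_density 0 s)" and "0 < s"
  shows "integrable M (\<lambda>\<omega>. (X \<omega>)\<^sup>2)" and "expectation (\<lambda>\<omega>. (X \<omega>)\<^sup>2) = s\<^sup>2"
proof -
  show "integrable M (\<lambda>\<omega>. (X \<omega>)\<^sup>2)"
    using integrable_normal_moment[OF assms(2), of 0 2]
    by (subst distributed_integrable[OF X, symmetric, where g="\<lambda>x. x\<^sup>2"]) auto
  show "expectation (\<lambda>\<omega>. (X \<omega>)\<^sup>2) = s\<^sup>2"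
    using normal_distributed_variance[OF assms(2) X] normal_distributed_expectation[OF assms(2) X]
    by simp
qed

lemma (in prob_space) prob_pos_if_distributed_pos_density:
  fixes X :: "'a \<Rightarrow> 'b::euclidean_space"
  assumes X: "distributed M lborel X f" and f: "\<And>z. 0 < f z" and S: "open S" "S \<noteq> {}"
  shows "0 < prob (X -` S \<inter> space M)"
proof -
  have [measurable]: "X \<in> borel_measurable M" "S \<in> sets borel"
    using distributed_measurable[OF X] S(1) by simp_all
  have "prob (X -` S \<inter> space M) \<noteq> 0"
  proof
    assume "prob (X -` S \<inter> space M) = 0"
    then have "AE \<omega> in M. \<omega> \<notin> X -` S \<inter> space M"
      by (subst (asm) prob_eq_0) auto
    then have "AE \<omega> in M. X \<omega> \<notin> S"
      using AE_space by eventually_elim auto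
    moreover have "(AE \<omega> in M. X \<omega> \<notin> S) \<longleftrightarrow> (AE z in lborel. 0 < f z \<longrightarrow> z \<notin> S)"
      by (rule distributed_AE2[OF X]) measurable
    ultimately have "AE z in lborel. z \<notin> S"
      using f by simp
    then have "S \<in> null_sets lborel"
      using S(1) by (simp add: AE_iff_null_sets)
    then show False
      using S open_not_negligible negligible_iff_null_sets null_sets_completionI by blast
  qed
  then show ?thesis using measure_nonneg[of M] by (simp add: less_le)
qed

section \<open>Unbounded images\<close>

lemma not_bounded_image_if_filterlim_at_top:
  fixes f :: "'a::topological_space \<Rightarrow> real"
  assumes "filterlim (\<lambda>y. \<bar>f y\<bar>) at_top (at z)" and "z islimpt D"
  shows "\<not> bounded (f ` D)"
proof
  assume "bounded (f ` D)"
  then obtain b where b: "\<And>y. y \<in> D \<Longrightarrow> \<bar>f y\<bar> \<le> b"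
    by (auto simp: bounded_iff)
  have "\<forall>\<^sub>F y in at z. b < \<bar>f y\<bar>"
    using assms(1) unfolding filterlim_at_top_dense by blast
  then have "\<forall>\<^sub>F y in at z within D. b < \<bar>f y\<bar>"
    by (rule filter_leD[OF at_le[OF subset_UNIV]])
  moreover have "\<forall>\<^sub>F y in at z within D. y \<in> D"
    by (simp add: eventually_at_topological) blast
  ultimately have "\<forall>\<^sub>F y in at z within D. False"
  proof eventually_elim
    case (elim y)
    then show ?case using b[of y] by simp
  qed
  then show False
    using assms(2) by (simp add: trivial_limit_within eventually_False)
qed

lemma islimpt_dense_Int_open:
  fixes z :: "'a::{perfect_space, t1_space}"
  assumes dense: "\<And>X. open X \<Longrightarrow> X \<noteq> {} \<Longrightarrow> \<exists>d\<in>D. d \<in> X" and S: "open S" "z \<in> S"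
  shows "z islimpt D \<inter> S"
proof (rule islimptI)
  fix T assume T: "z \<in> T" "open T"
  then obtain y where "y \<in> T \<inter> S" "y \<noteq> z"
    using S islimptE[OF islimpt_UNIV, of z "T \<inter> S"] by auto
  moreover have "open (T \<inter> S - {z})"
    using S(1) T(2) by (intro open_delete open_Int)
  ultimately obtain d where "d \<in> D" "d \<in> T \<inter> S - {z}"
    using dense[of "T \<inter> S - {z}"] by blast
  then show "\<exists>y\<in>D \<inter> S. y \<in> T \<and> y \<noteq> z"
    by auto
qed

lemma SUP_ereal_abs_eq_PInfty:
  assumes "\<not> bounded (f ` D)" and "D \<subseteq> A"
  shows "(SUP y\<in>A. ereal \<bar>f y\<bar>) = \<infinity>"
proof (rule SUP_PInfty)
  fix n :: nat
  obtain y where "y \<in> D" "real n < \<bar>f y\<bar>"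
    using assms(1) by (auto simp: bounded_iff not_le)
  then show "\<exists>y\<in>A. ereal (real n) \<le> ereal \<bar>f y\<bar>"
    using assms(2) by (intro bexI[of _ y]) auto
qed

lemma bounded_if_bounded_affine_images:
  fixes T R :: "'i \<Rightarrow> real"
  assumes "bounded ((\<lambda>i. T i * u + R i) ` I)" "bounded ((\<lambda>i. T i * v + R i) ` I)" "u \<noteq> v"
  shows "bounded (T ` I)"
proof -
  have "bounded ((\<lambda>i. (T i * u + R i) - (T i * v + R i)) ` I)"
    using assms(1,2) by (rule bounded_minus_comp)
  then have "bounded ((\<lambda>x. inverse (u - v) *\<^sub>R x) ` (\<lambda>i. (T i * u + R i) - (T i * v + R i)) ` I)"
    by (rule bounded_scaling)
  moreover have "inverse (u - v) *\<^sub>R ((T i * u + R i) - (T i * v + R i)) = T i" for i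
    using assms(3) by (simp add: field_simps)
  ultimately show ?thesis by (simp add: image_image)
qed

lemma pred_bounded_image:
  fixes f :: "'i \<Rightarrow> 'a \<Rightarrow> real"
  assumes "countable I" and [measurable]: "\<And>i. i \<in> I \<Longrightarrow> f i \<in> borel_measurable N"
  shows "Measurable.pred N (\<lambda>\<omega>. bounded ((\<lambda>i. f i \<omega>) ` I))"
proof -
  have "bounded ((\<lambda>i. f i \<omega>) ` I) \<longleftrightarrow> (\<exists>n::nat. \<forall>i\<in>I. \<bar>f i \<omega>\<bar> \<le> real n)" for \<omega>
  proof
    assume "bounded ((\<lambda>i. f i \<omega>) ` I)"
    then obtain c where c: "\<forall>i\<in>I. \<bar>f i \<omega>\<bar> \<le> c"
      by (auto simp: bounded_iff)
    obtain n :: nat where "c \<le> real n"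
      using real_arch_simple by blast
    with c show "\<exists>n::nat. \<forall>i\<in>I. \<bar>f i \<omega>\<bar> \<le> real n"
      by (blast intro: order_trans)
  qed (auto simp: bounded_iff)
  moreover have "Measurable.pred N (\<lambda>\<omega>. \<exists>n::nat. \<forall>i\<in>I. \<bar>f i \<omega>\<bar> \<le> real n)"
    using assms(1) by measurable
  ultimately show ?thesis by simp
qed

lemma (in prob_space) AE_bounded_affine_imp_bounded:
  fixes T R :: "'i \<Rightarrow> 'a \<Rightarrow> real"
  assumes indep: "indep_of_subalgebra F borel g" and atomless: "\<And>u. AE \<omega> in M. g \<omega> \<noteq> u"
    and I: "countable I"
    and [measurable]: "\<And>i. i \<in> I \<Longrightarrow> T i \<in> borel_measurable F"
      "\<And>i. i \<in> I \<Longrightarrow> R i \<in> borel_measurable F"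
  shows "AE \<omega> in M. bounded ((\<lambda>i. T i \<omega> * g \<omega> + R i \<omega>) ` I) \<longrightarrow> bounded ((\<lambda>i. T i \<omega>) ` I)"
proof (rule AE_freezing[OF indep])
  have [measurable]:
    "Measurable.pred (F \<Otimes>\<^sub>M borel) (\<lambda>p. bounded ((\<lambda>i. T i (fst p) * snd p + R i (fst p)) ` I))"
    "Measurable.pred (F \<Otimes>\<^sub>M borel) (\<lambda>p. bounded ((\<lambda>i. T i (fst p)) ` I))"
    by (rule pred_bounded_image[OF I], measurable)+
  show "Measurable.pred (F \<Otimes>\<^sub>M borel) (\<lambda>(\<omega>, u).
      bounded ((\<lambda>i. T i \<omega> * u + R i \<omega>) ` I) \<longrightarrow> bounded ((\<lambda>i. T i \<omega>) ` I))"
    unfolding split_beta by measurable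
  show "AE \<omega>' in M. bounded ((\<lambda>i. T i \<omega> * g \<omega>' + R i \<omega>) ` I) \<longrightarrow> bounded ((\<lambda>i. T i \<omega>) ` I)" for \<omega>
  proof (cases "\<exists>u. bounded ((\<lambda>i. T i \<omega> * u + R i \<omega>) ` I)")
    case True
    then obtain u where u: "bounded ((\<lambda>i. T i \<omega> * u + R i \<omega>) ` I)" by blast
    show ?thesis
      using atomless[of u] by eventually_elim (auto intro: bounded_if_bounded_affine_images[OF u])
  qed simp
qed

section \<open>The Poisson arrival times\<close>

lemma (in prob_space) nn_integral_exp_minus_exponential:
  assumes X: "distributed M lborel X (exponential_density l)" and l: "0 < l"
  shows "(\<integral>\<^sup>+ \<omega>. ennreal (exp (- X \<omega>)) \<partial>M) = ennreal (l / (1 + l))"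
proof -
  interpret exponential: prob_space "density lborel (exponential_density (1 + l))"
    using l by (intro prob_space_exponential_density) simp
  have "(\<integral>\<^sup>+ \<omega>. ennreal (exp (- X \<omega>)) \<partial>M) =
      (\<integral>\<^sup>+ x. ennreal (exponential_density l x) * ennreal (exp (- x)) \<partial>lborel)"
    by (rule distributed_nn_integral[OF X, symmetric]) measurable
  also have "\<dots> = (\<integral>\<^sup>+ x. ennreal (l / (1 + l)) * ennreal (exponential_density (1 + l) x) \<partial>lborel)"
    using l by (intro nn_integral_cong)
      (simp add: ennreal_mult[symmetric] exponential_density_def mult_exp_exp distrib_left)
  also have "\<dots> = ennreal (l / (1 + l)) * (\<integral>\<^sup>+ x. ennreal (exponential_density (1 + l) x) \<partial>lborel)"
    by (rule nn_integral_cmult) measurable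
  also have "(\<integral>\<^sup>+ x. ennreal (exponential_density (1 + l) x) \<partial>lborel) = 1"
    using exponential.emeasure_space_1 by (simp add: emeasure_density)
  finally show ?thesis by simp
qed

locale unit_rate_arrivals = prob_space M for M :: "'a measure" +
  fixes E :: "nat \<Rightarrow> 'a \<Rightarrow> real"
  assumes E_distributed: "\<And>i. distributed M lborel (E i) (exponential_density 1)"
    and E_indep: "indep_vars (\<lambda>_. borel) E UNIV"
begin

lemma E_measurable [measurable]: "E i \<in> borel_measurable M"
  using distributed_measurable[OF E_distributed] by simp

lemma AE_arrival_pos: "AE \<omega> in M. \<forall>k. 0 < arrival E k \<omega>"
proof -
  have "AE x in lborel. 0 < ennreal (exponential_density 1 x) \<longrightarrow> 0 < x"
    using AE_lborel_singleton[of "0::real"]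
    by eventually_elim (auto simp: exponential_density_def)
  then have "AE \<omega> in M. 0 < E i \<omega>" for i
    by (subst distributed_AE2[OF E_distributed]) auto
  then have "AE \<omega> in M. \<forall>i. 0 < E i \<omega>"
    by (simp add: AE_all_countable)
  then show ?thesis
    by eventually_elim (auto simp: arrival_def intro!: sum_pos)
qed

lemma nn_integral_exp_minus_arrival:
  "(\<integral>\<^sup>+ \<omega>. ennreal (exp (- arrival E k \<omega>)) \<partial>M) = ennreal ((1 / 2) ^ Suc k)"
proof -
  have "(\<integral>\<^sup>+ \<omega>. ennreal (exp (- arrival E k \<omega>)) \<partial>M) = (\<integral>\<^sup>+ \<omega>. (\<Prod>i\<le>k. ennreal (exp (- E i \<omega>))) \<partial>M)"
    by (simp add: prod_ennreal arrival_def exp_sum sum_negf[symmetric])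
  also have "\<dots> = (\<Prod>i\<le>k. \<integral>\<^sup>+ \<omega>. ennreal (exp (- E i \<omega>)) \<partial>M)"
    by (intro indep_vars_nn_integral indep_vars_compose2[OF indep_vars_subset[OF E_indep]]) auto
  also have "\<dots> = (\<Prod>i\<le>k. ennreal (1 / 2))"
    using nn_integral_exp_minus_exponential[OF E_distributed] by simp
  also have "\<dots> = ennreal ((1 / 2) ^ Suc k)"
    by (subst prod_ennreal) simp_all
  finally show ?thesis .
qed

lemma arrival_measurable [measurable]: "arrival E k \<in> borel_measurable M"
  unfolding arrival_def[abs_def] by measurable

lemma prob_arrival_le:
  "prob {\<omega> \<in> space M. arrival E k \<omega> \<le> real (Suc k) / 2} \<le> (exp (1 / 2) / 2) ^ Suc k"
proof -
  have "emeasure M {\<omega> \<in> space M. arrival E k \<omega> \<le> real (Suc k) / 2}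
      \<le> ennreal (exp (real (Suc k) / 2)) * ennreal ((1 / 2) ^ Suc k)"
    using Chernoff_ineq_nn_integral_le[of 1 "space M" M "arrival E k" "real (Suc k) / 2"]
    by (simp add: nn_integral_exp_minus_arrival cong: nn_integral_cong)
  also have "\<dots> = ennreal ((exp (1 / 2) / 2) ^ Suc k)"
    using exp_of_nat_mult[of "Suc k" "1 / 2 :: real"]
    by (simp add: ennreal_mult[symmetric] power_divide)
  finally show ?thesis by (simp add: emeasure_eq_measure)
qed

lemma AE_arrival_ge_linear: "AE \<omega> in M. \<forall>\<^sub>F k in sequentially. real (Suc k) / 2 \<le> arrival E k \<omega>"
proof -
  let ?early = "\<lambda>k. {\<omega> \<in> space M. arrival E k \<omega> \<le> real (Suc k) / 2}"
  have "(exp (1 / 2) :: real)\<^sup>2 < 2\<^sup>2"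
    using exp_le by (simp add: exp_double[symmetric])
  then have "exp (1 / 2) < (2 :: real)"
    by (rule power2_less_imp_less) simp
  then have "summable (\<lambda>k. (exp (1 / 2) / 2 :: real) ^ Suc k)"
    by (subst summable_Suc_iff) (simp add: summable_geometric)
  then have "summable (\<lambda>k. prob (?early k))"
    by (rule summable_comparison_test'[where N=0]) (use prob_arrival_le in simp)
  then have "AE \<omega> in M. \<forall>\<^sub>F k in sequentially. \<omega> \<in> space M - ?early k"
    by (intro borel_cantelli_AE1) (auto simp: emeasure_eq_measure)
  then show ?thesis
    by eventually_elim (auto elim!: eventually_mono)
qed

text \<open>Negative powers of the arrival times need not be square integrable, those of the clipped
  arrival times are bounded, and almost surely only finitely many terms are changed.\<close>
definition clipped_arrival :: "nat \<Rightarrow> 'a \<Rightarrow> real" where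
  "clipped_arrival k \<omega> = max (arrival E k \<omega>) (real (Suc k) / 2)"

lemma AE_eventually_clipped_arrival_eq:
  "AE \<omega> in M. \<forall>\<^sub>F k in sequentially. clipped_arrival k \<omega> = arrival E k \<omega>"
  using AE_arrival_ge_linear
  by eventually_elim (auto simp: clipped_arrival_def elim!: eventually_mono)

lemma clipped_arrival_powr_square_le:
  assumes "0 < \<alpha>"
  shows "(clipped_arrival k \<omega> powr (-1 / \<alpha>))\<^sup>2 \<le> (real (Suc k) / 2) powr (-2 / \<alpha>)"
proof -
  have "(clipped_arrival k \<omega> powr (-1 / \<alpha>))\<^sup>2 = clipped_arrival k \<omega> powr (-2 / \<alpha>)"
    by (simp add: power2_eq_square powr_add[symmetric])
  also have "\<dots> \<le> (real (Suc k) / 2) powr (-2 / \<alpha>)"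
    using assms by (intro powr_mono2') (auto simp: clipped_arrival_def)
  finally show ?thesis .
qed

end

section \<open>The LePage series\<close>

locale lepage_sequences = prob_space M for M :: "'a measure" +
  fixes E g :: "nat \<Rightarrow> 'a \<Rightarrow> real" and \<xi> :: "nat \<Rightarrow> 'a \<Rightarrow> real^2"
  assumes E_random_variable [measurable]: "\<And>n. random_variable borel (E n)"
    and g_random_variable [measurable]: "\<And>n. random_variable borel (g n)"
    and \<xi>_random_variable [measurable]: "\<And>n. random_variable borel (\<xi> n)"
    and indep: "lepage_indep M E \<xi> g"
begin

definition generated_events :: "nat + nat + nat \<Rightarrow> 'a set set" where
  "generated_events i = (case i of
        Inl n \<Rightarrow> {E n -` A \<inter> space M | A. A \<in> sets borel}
      | Inr (Inl n) \<Rightarrow> {\<xi> n -` A \<inter> space M | A. A \<in> sets borel}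
      | Inr (Inr n) \<Rightarrow> {g n -` A \<inter> space M | A. A \<in> sets borel})"

lemma indep_generated_events: "indep_sets generated_events UNIV"
  using indep unfolding lepage_indep_def generated_events_def[abs_def] .

lemma generated_events_subset: "generated_events i \<subseteq> events"
  using indep_generated_events by (auto simp: indep_sets_def)

lemma indep_vars_E: "indep_vars (\<lambda>_. borel) E UNIV"
  using indep_sets_reindex[OF indep_generated_events, of Inl]
  by (simp add: indep_vars_def2 generated_events_def)

lemma indep_vars_\<xi>: "indep_vars (\<lambda>_. borel) \<xi> UNIV"
  using indep_sets_reindex[OF indep_generated_events, of "\<lambda>n. Inr (Inl n)"]
  by (simp add: indep_vars_def2 generated_events_def inj_def)

definition algebra_except_g :: "nat \<Rightarrow> 'a measure" where
  "algebra_except_g j = sigma (space M) (\<Union>i\<in>-{Inr (Inr j)}. generated_events i)"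

lemma space_algebra_except_g [simp]: "space (algebra_except_g j) = space M"
  by (simp add: algebra_except_g_def space_measure_of_conv)

lemma sets_algebra_except_g:
  "sets (algebra_except_g j) = sigma_sets (space M) (\<Union>i\<in>-{Inr (Inr j)}. generated_events i)"
  unfolding algebra_except_g_def using generated_events_subset sets.space_closed
  by (intro sets_measure_of) blast

lemma measurable_algebra_except_gI:
  assumes "\<And>A. A \<in> sets N \<Longrightarrow> X -` A \<inter> space M \<in> generated_events i"
    and "i \<noteq> Inr (Inr j)" and "random_variable N X"
  shows "X \<in> measurable (algebra_except_g j) N"
proof (rule measurableI)
  show "X \<omega> \<in> space N" if "\<omega> \<in> space (algebra_except_g j)" for \<omega>
    using measurable_space[OF assms(3)] that by simp
  show "X -` A \<inter> space (algebra_except_g j) \<in> sets (algebra_except_g j)" if "A \<in> sets N" for A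
    using assms(1)[OF that] assms(2) by (auto simp: sets_algebra_except_g intro!: sigma_sets.Basic)
qed

lemma E_measurable_except_g [measurable]: "E n \<in> borel_measurable (algebra_except_g j)"
  by (rule measurable_algebra_except_gI[where i="Inl n"]) (auto simp: generated_events_def)

lemma \<xi>_measurable_except_g [measurable]: "\<xi> n \<in> borel_measurable (algebra_except_g j)"
  by (rule measurable_algebra_except_gI[where i="Inr (Inl n)"]) (auto simp: generated_events_def)

lemma g_measurable_except_g: "n \<noteq> j \<Longrightarrow> g n \<in> borel_measurable (algebra_except_g j)"
  by (rule measurable_algebra_except_gI[where i="Inr (Inr n)"]) (auto simp: generated_events_def)

lemma indep_of_algebra_except_g: "indep_of_subalgebra (algebra_except_g j) borel (g j)"
proof -
  have "Int_stable (generated_events i)" for i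
    by (auto simp: generated_events_def Int_stable_vimage_sets split: sum.split)
  then have "indep_set (sets (algebra_except_g j))
      (sigma_sets (space M) (generated_events (Inr (Inr j))))"
    using indep_set_sigma_sets_Union[OF indep_generated_events, of "-{Inr (Inr j)}" "{Inr (Inr j)}"]
    by (simp add: sets_algebra_except_g)
  then show ?thesis
    unfolding indep_of_subalgebra_def indep_sets2_eq
    by (auto simp: subalgebra_def generated_events_def intro: sigma_sets.Basic)
qed

end

locale lepage_series = lepage_sequences M E g \<xi>
  for M :: "'a measure" and E g \<xi> +
  fixes \<alpha> v :: real and \<phi> :: "real^2 \<Rightarrow> real"
  assumes \<alpha>_pos: "0 < \<alpha>" and \<alpha>_less_2: "\<alpha> < 2"
    and \<phi>_pos: "\<And>z. 0 < \<phi> z"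
    and E_exponential: "\<And>i. distributed M lborel (E i) (exponential_density 1)"
    and \<xi>_distributed: "\<And>k. distributed M lborel (\<xi> k) \<phi>"
    and g_centred: "\<And>k. expectation (g k) = 0"
    and g_square_integrable: "\<And>k. integrable M (\<lambda>\<omega>. (g k \<omega>)\<^sup>2)"
    and g_second_moment: "\<And>k. expectation (\<lambda>\<omega>. (g k \<omega>)\<^sup>2) \<le> v"
    and g_atomless: "\<And>k u. AE \<omega> in M. g k \<omega> \<noteq> u"
begin

sublocale unit_rate_arrivals M E
  by unfold_locales (rule E_exponential indep_vars_E)+

lemma second_moment_comp_\<xi>:
  assumes "f \<in> borel_measurable borel" and "integrable lborel (\<lambda>z. \<phi> z * (f z)\<^sup>2)"
  shows "integrable M (\<lambda>\<omega>. (f (\<xi> k \<omega>))\<^sup>2)"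
    and "expectation (\<lambda>\<omega>. (f (\<xi> k \<omega>))\<^sup>2) = (\<integral>z. \<phi> z * (f z)\<^sup>2 \<partial>lborel)"
  using assms distributed_integrable[OF \<xi>_distributed, of "\<lambda>z. (f z)\<^sup>2" k]
    distributed_integral[OF \<xi>_distributed, of "\<lambda>z. (f z)\<^sup>2" k] \<phi>_pos
  by (auto simp: less_imp_le)

definition clipped_weight :: "(real^2 \<Rightarrow> real) \<Rightarrow> nat \<Rightarrow> 'a \<Rightarrow> real" where
  "clipped_weight f k \<omega> = clipped_arrival k \<omega> powr (-1 / \<alpha>) * f (\<xi> k \<omega>)"

lemma clipped_weight_measurable [measurable (raw)]:
  assumes [measurable]: "\<And>i. E i \<in> borel_measurable N" "\<And>i. \<xi> i \<in> borel_measurable N"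
    "f \<in> borel_measurable borel"
  shows "clipped_weight f k \<in> borel_measurable N"
  unfolding clipped_weight_def[abs_def] clipped_arrival_def arrival_def by measurable

lemma clipped_weight_second_moment:
  assumes [measurable]: "f \<in> borel_measurable borel"
    and "integrable lborel (\<lambda>z. \<phi> z * (f z)\<^sup>2)"
  shows "integrable M (\<lambda>\<omega>. (clipped_weight f k \<omega>)\<^sup>2)"
    and "expectation (\<lambda>\<omega>. (clipped_weight f k \<omega>)\<^sup>2)
      \<le> (real (Suc k) / 2) powr (-2 / \<alpha>) * (\<integral>z. \<phi> z * (f z)\<^sup>2 \<partial>lborel)"
proof -
  let ?b = "\<lambda>\<omega>. (real (Suc k) / 2) powr (-2 / \<alpha>) * (f (\<xi> k \<omega>))\<^sup>2"
  have square_le: "(clipped_weight f k \<omega>)\<^sup>2 \<le> ?b \<omega>" for \<omega>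
    unfolding clipped_weight_def power_mult_distrib
    by (intro mult_right_mono clipped_arrival_powr_square_le \<alpha>_pos) simp
  have integrable_bound: "integrable M ?b"
    by (rule integrable_mult_right[OF second_moment_comp_\<xi>(1)[OF assms]])
  show integrable_square: "integrable M (\<lambda>\<omega>. (clipped_weight f k \<omega>)\<^sup>2)"
  proof (rule Bochner_Integration.integrable_bound[OF integrable_bound])
    show "AE \<omega> in M. norm ((clipped_weight f k \<omega>)\<^sup>2) \<le> norm (?b \<omega>)"
      using order_trans[OF square_le abs_ge_self] by (intro AE_I2) simp
  qed measurable
  show "expectation (\<lambda>\<omega>. (clipped_weight f k \<omega>)\<^sup>2)
      \<le> (real (Suc k) / 2) powr (-2 / \<alpha>) * (\<integral>z. \<phi> z * (f z)\<^sup>2 \<partial>lborel)"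
    using integral_mono[OF integrable_square integrable_bound square_le]
    by (simp add: second_moment_comp_\<xi>(2)[OF assms])
qed

lemma summable_clipped_weight_second_moments:
  assumes "f \<in> borel_measurable borel" and "integrable lborel (\<lambda>z. \<phi> z * (f z)\<^sup>2)"
  shows "summable (\<lambda>k. expectation (\<lambda>\<omega>. (clipped_weight f k \<omega>)\<^sup>2))"
proof (rule summable_comparison_test')
  have "summable (\<lambda>k. real (Suc k) powr (-2 / \<alpha>))"
    using \<alpha>_pos \<alpha>_less_2 by (subst summable_Suc_iff) (simp add: summable_real_powr_iff field_simps)
  then have "summable (\<lambda>k. (real (Suc k) / 2) powr (-2 / \<alpha>))"
    by (simp add: powr_divide summable_divide)
  then show "summable (\<lambda>k. (real (Suc k) / 2) powr (-2 / \<alpha>) * (\<integral>z. \<phi> z * (f z)\<^sup>2 \<partial>lborel))"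
    by (rule summable_mult2)
  show "norm (expectation (\<lambda>\<omega>. (clipped_weight f k \<omega>)\<^sup>2))
      \<le> (real (Suc k) / 2) powr (-2 / \<alpha>) * (\<integral>z. \<phi> z * (f z)\<^sup>2 \<partial>lborel)" for k
    using clipped_weight_second_moment(2)[OF assms] by simp
qed

lemma AE_summable_weighted_arrivals:
  assumes [measurable]: "f \<in> borel_measurable borel"
    and "integrable lborel (\<lambda>z. \<phi> z * (f z)\<^sup>2)"
  shows "AE \<omega> in M. summable (\<lambda>k. arrival E k \<omega> powr (-1 / \<alpha>) * f (\<xi> k \<omega>) * g k \<omega>)"
proof -
  have predictable: "clipped_weight f k \<in> borel_measurable (algebra_except_g j)" for k j
    by measurable
  have "AE \<omega> in M. summable (\<lambda>k. clipped_weight f k \<omega> * g k \<omega>)"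
  proof (rule AE_summable_martingale_transform)
    show "indep_of_subalgebra (algebra_except_g n) borel (g n)" for n
      by (rule indep_of_algebra_except_g)
    show "(\<lambda>\<omega>. clipped_weight f i \<omega> * g i \<omega>) \<in> borel_measurable (algebra_except_g n)"
      if "i < n" for i n
      using that by (intro borel_measurable_times predictable g_measurable_except_g) simp
  qed (fact predictable clipped_weight_second_moment(1)[OF assms] g_square_integrable g_centred
      g_second_moment summable_clipped_weight_second_moments[OF assms])+
  with AE_eventually_clipped_arrival_eq show ?thesis
  proof eventually_elim
    case (elim \<omega>)
    have "\<forall>\<^sub>F k in sequentially. clipped_weight f k \<omega> * g k \<omega>
        = arrival E k \<omega> powr (-1 / \<alpha>) * f (\<xi> k \<omega>) * g k \<omega>"
      using elim(1) by eventually_elim (simp only: clipped_weight_def)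
    then show ?case using elim(2) by (rule summable_cong[THEN iffD1])
  qed
qed

end

section \<open>Integrability of negative powers of the norm\<close>

lemma norm_powr_le_suminf_dyadic:
  fixes y z :: "'a::real_normed_vector"
  assumes "0 \<le> p" and z: "z \<in> ball y R" "z \<noteq> y"
  shows "ennreal (norm (y - z) powr -p) * indicator (ball y R) z
    \<le> (\<Sum>n. ennreal ((R / 2 ^ Suc n) powr -p) * indicator (ball y (R / 2 ^ n)) z)"
proof -
  have d: "0 < norm (y - z)" "norm (y - z) < R"
    using z by (auto simp: dist_norm)
  then have R: "0 < R" by linarith
  obtain m where "R / norm (y - z) < 2 ^ m"
    using real_arch_pow[of 2] by auto
  then have "R / 2 ^ m \<le> norm (y - z)"
    using d by (simp add: field_simps)
  then obtain n where n: "norm (y - z) < R / 2 ^ n" "R / 2 ^ Suc n \<le> norm (y - z)"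
    using ex_least_nat_less[of "\<lambda>n. R / 2 ^ n \<le> norm (y - z)" m] d by (auto simp: not_le)
  have "ennreal (norm (y - z) powr -p) * indicator (ball y R) z
      \<le> ennreal ((R / 2 ^ Suc n) powr -p) * indicator (ball y (R / 2 ^ n)) z"
    using n z assms(1) R by (auto simp: dist_norm intro!: ennreal_leI powr_mono2')
  also have "\<dots> \<le> (\<Sum>n. ennreal ((R / 2 ^ Suc n) powr -p) * indicator (ball y (R / 2 ^ n)) z)"
    using sum_le_suminf[OF summableI, of "{n}"
        "\<lambda>n. ennreal ((R / 2 ^ Suc n) powr -p) * indicator (ball y (R / 2 ^ n)) z"]
    by (simp del: sum_mult_indicator)
  finally show ?thesis .
qed

lemma summable_dyadic_powr:
  fixes c R :: real
  assumes "0 < c" and "0 \<le> R"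
  shows "summable (\<lambda>n. (R / 2 ^ n) powr c)"
proof -
  have "(R / 2 ^ n) powr c = R powr c * (2 powr -c) ^ n" for n
  proof -
    have "(R / 2 ^ n) powr c = R powr c * (2 ^ n) powr -c"
      using assms(2) powr_minus_divide[of "2 ^ n" c] by (simp add: powr_divide)
    also have "(2 ^ n) powr -c = (2 powr -c) ^ n"
      by (simp add: powr_realpow[symmetric] powr_powr mult.commute)
    finally show ?thesis .
  qed
  moreover have "norm (2 powr -c :: real) < 1"
    using assms(1) by (simp add: powr_less_one)
  ultimately show ?thesis
    by (simp only: summable_mult summable_geometric)
qed

lemma nn_integral_norm_powr_ball_finite:
  fixes y :: "'a::euclidean_space" and p :: real
  assumes p: "0 \<le> p" "p < DIM('a)" and R: "0 < R"
  shows "(\<integral>\<^sup>+ z. ennreal (norm (y - z) powr -p) * indicator (ball y R) z \<partial>lborel) < \<infinity>"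
proof -
  let ?d = "real DIM('a)" and ?c = "\<lambda>n. (R / 2 ^ Suc n) powr -p" and ?B = "\<lambda>n. ball y (R / 2 ^ n)"
  define K where "K = 2 powr p * unit_ball_vol ?d"
  have shell: "(\<integral>\<^sup>+ z. ennreal (?c n) * indicator (?B n) z \<partial>lborel)
      = ennreal (K * (R / 2 ^ n) powr (?d - p))" for n
  proof -
    have "?c n = 2 powr p * (R / 2 ^ n) powr -p"
      using R by (simp add: powr_minus_divide powr_divide powr_mult)
    then have "?c n * (unit_ball_vol ?d * (R / 2 ^ n) ^ DIM('a)) = K * (R / 2 ^ n) powr (?d - p)"
      using R by (simp add: K_def powr_realpow[symmetric] powr_add[symmetric])
    then show ?thesis
      using R
      by (subst nn_integral_cmult_indicator) (simp_all add: emeasure_ball ennreal_mult[symmetric])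
  qed
  have "ennreal (norm (y - z) powr -p) * indicator (ball y R) z
      \<le> (\<Sum>n. ennreal (?c n) * indicator (?B n) z)" if "z \<noteq> y" for z
    using norm_powr_le_suminf_dyadic[OF p(1) _ that] by (cases "z \<in> ball y R") simp_all
  moreover have "AE z in lborel. z \<noteq> y" by (rule AE_lborel_singleton)
  ultimately have "(\<integral>\<^sup>+ z. ennreal (norm (y - z) powr -p) * indicator (ball y R) z \<partial>lborel)
      \<le> (\<integral>\<^sup>+ z. (\<Sum>n. ennreal (?c n) * indicator (?B n) z) \<partial>lborel)"
    by (intro nn_integral_mono_AE) auto
  also have "\<dots> = (\<Sum>n. \<integral>\<^sup>+ z. ennreal (?c n) * indicator (?B n) z \<partial>lborel)"
    by (rule nn_integral_suminf)
      (intro borel_measurable_times_ennreal borel_measurable_indicator, auto)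
  also have "\<dots> = (\<Sum>n. ennreal (K * (R / 2 ^ n) powr (?d - p)))"
    by (simp only: shell)
  also have "\<dots> = ennreal (\<Sum>n. K * (R / 2 ^ n) powr (?d - p))"
    using p(2) R by (intro suminf_ennreal2 summable_mult summable_dyadic_powr) (simp_all add: K_def)
  finally show ?thesis by (rule le_less_trans) simp
qed

section \<open>The wave kernel\<close>

lemma
  assumes "1 \<le> (x::real)"
  shows ln_le_arcosh: "ln x \<le> arcosh x" and arcosh_le_ln_double: "arcosh x \<le> ln (2 * x)"
proof -
  have "0 \<le> sqrt (x\<^sup>2 - 1)"
    using assms by (simp add: one_le_power)
  moreover have "sqrt (x\<^sup>2 - 1) \<le> sqrt (x\<^sup>2)"
    by (rule real_sqrt_le_mono) simp
  ultimately show "ln x \<le> arcosh x" "arcosh x \<le> ln (2 * x)"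
    using assms unfolding arcosh_real_def[OF assms] real_sqrt_abs by (intro ln_mono; linarith)+
qed

lemma arcosh_square_le:
  assumes "1 \<le> (x::real)"
  shows "(arcosh x)\<^sup>2 \<le> 8 * x"
proof -
  have "arcosh x \<le> ln (2 * x)"
    by (rule arcosh_le_ln_double[OF assms])
  also have "\<dots> = 2 * ln (sqrt (2 * x))"
    using assms by (simp add: ln_sqrt)
  also have "\<dots> \<le> 2 * sqrt (2 * x)"
    using ln_le_minus_one[of "sqrt (2 * x)"] assms by simp
  finally have "(arcosh x)\<^sup>2 \<le> (2 * sqrt (2 * x))\<^sup>2"
    using assms by (intro power_mono) auto
  then show ?thesis using assms by (simp add: power_mult_distrib)
qed

definition light_cone_density :: "real \<Rightarrow> real \<Rightarrow> real \<Rightarrow> real \<Rightarrow> real \<Rightarrow> real" where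
  "light_cone_density a t r b \<tau> =
    indicator {b..t - r / a} \<tau> * (1 / sqrt (a\<^sup>2 * (t - \<tau>)\<^sup>2 - r\<^sup>2))"

lemma light_cone_density_nonneg:
  assumes "0 < a" and "0 \<le> r"
  shows "0 \<le> light_cone_density a t r b \<tau>"
proof -
  have "r\<^sup>2 \<le> a\<^sup>2 * (t - \<tau>)\<^sup>2" if "\<tau> \<le> t - r / a"
  proof -
    have "r \<le> a * (t - \<tau>)"
      using that assms by (simp add: field_simps)
    then have "r\<^sup>2 \<le> (a * (t - \<tau>))\<^sup>2"
      using assms(2) by (intro power_mono)
    then show ?thesis by (simp add: power_mult_distrib)
  qed
  then show ?thesis
    by (auto simp: light_cone_density_def split: split_indicator)
qed

lemma has_real_derivative_light_cone_primitive:
  fixes a r t \<tau> :: real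
  assumes a: "0 < a" and r: "0 < r" and "r < a * (t - \<tau>)"
  shows "((\<lambda>\<tau>. - (arcosh (a * (t - \<tau>) / r) / a)) has_real_derivative
    1 / sqrt (a\<^sup>2 * (t - \<tau>)\<^sup>2 - r\<^sup>2)) (at \<tau>)"
proof -
  have "1 < a * (t - \<tau>) / r"
    using assms by simp
  moreover have "((\<lambda>\<tau>. a * (t - \<tau>) / r) has_real_derivative - a / r) (at \<tau>)"
    using r by (auto intro!: derivative_eq_intros)
  ultimately have "((\<lambda>\<tau>. arcosh (a * (t - \<tau>) / r)) has_real_derivative
      1 / sqrt ((a * (t - \<tau>) / r)\<^sup>2 - 1) * (- a / r)) (at \<tau>)"
    by (intro DERIV_chain2[OF arcosh_real_has_field_derivative])
  note primitive = DERIV_minus[OF DERIV_cdivide[OF this, of a]]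
  have "a\<^sup>2 * (t - \<tau>)\<^sup>2 - r\<^sup>2 = r\<^sup>2 * ((a * (t - \<tau>) / r)\<^sup>2 - 1)"
    unfolding power_divide power_mult_distrib using r by (simp add: field_simps)
  then have "sqrt (a\<^sup>2 * (t - \<tau>)\<^sup>2 - r\<^sup>2) = r * sqrt ((a * (t - \<tau>) / r)\<^sup>2 - 1)"
    using r by (simp add: real_sqrt_mult)
  then show ?thesis
    using primitive a by (simp add: mult.commute)
qed

lemma has_bochner_integral_light_cone_density:
  fixes a b r t :: real
  assumes a: "0 < a" and r: "0 < r" and b: "b \<le> t - r / a"
  shows "has_bochner_integral lborel (light_cone_density a t r b) (arcosh (a * (t - b) / r) / a)"
proof -
  let ?s = "t - r / a"
  let ?F = "\<lambda>\<tau>. - (arcosh (a * (t - \<tau>) / r) / a)"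
  let ?f = "\<lambda>\<tau>. 1 / sqrt (a\<^sup>2 * (t - \<tau>)\<^sup>2 - r\<^sup>2)"
  have ge_1: "1 \<le> a * (t - \<tau>) / r" if "\<tau> \<le> ?s" for \<tau>
    using that a r by (simp add: field_simps)
  have "(?f has_integral (?F ?s - ?F b)) {b..?s}"
  proof (rule fundamental_theorem_of_calculus_interior[OF b])
    show "continuous_on {b..?s} ?F"
      using ge_1 a r by (intro continuous_intros) auto
    show "(?F has_vector_derivative ?f \<tau>) (at \<tau>)" if "\<tau> \<in> {b<..<?s}" for \<tau>
      unfolding has_real_derivative_iff_has_vector_derivative[symmetric]
      using that a r by (intro has_real_derivative_light_cone_primitive) (auto simp: field_simps)
  qed
  moreover have "?F ?s - ?F b = arcosh (a * (t - b) / r) / a"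
    using a r by simp
  moreover have "light_cone_density a t r b = (\<lambda>\<tau>. if \<tau> \<in> {b..?s} then ?f \<tau> else 0)"
    by (auto simp: light_cone_density_def indicator_def)
  ultimately have "(light_cone_density a t r b has_integral (arcosh (a * (t - b) / r) / a)) UNIV"
    by (simp only: has_integral_restrict_UNIV)
  moreover have "light_cone_density a t r b \<in> borel_measurable borel"
    unfolding light_cone_density_def[abs_def] by measurable
  moreover have "0 \<le> light_cone_density a t r b \<tau>" for \<tau>
    using a r by (intro light_cone_density_nonneg) auto
  ultimately show ?thesis
    using ge_1[OF b] a
    by (intro has_bochner_integral_nn_integral nn_integral_has_integral_lborel) auto
qed

locale wave_kernel =
  fixes a t B :: real and \<sigma> :: "real^2 \<Rightarrow> real \<Rightarrow> real"
  assumes a_pos: "0 < a" and t_pos: "0 < t"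
    and \<sigma>_continuous: "continuous_on (UNIV \<times> {0..}) (\<lambda>(y, \<tau>). \<sigma> y \<tau>)"
    and \<sigma>_bounded: "\<And>y \<tau>. 0 \<le> \<tau> \<Longrightarrow> \<bar>\<sigma> y \<tau>\<bar> \<le> B"
begin

lemma B_nonneg: "0 \<le> B"
  using \<sigma>_bounded[of 0 0] by simp

lemma \<sigma>_measurable [measurable (raw)]:
  assumes [measurable]: "f \<in> borel_measurable N" "h \<in> borel_measurable N"
  shows "(\<lambda>w. indicator {0..} (h w) * \<sigma> (f w) (h w)) \<in> borel_measurable N"
proof -
  have "(\<lambda>p. indicator (UNIV \<times> {0..}) p *\<^sub>R (case p of (z, \<tau>) \<Rightarrow> \<sigma> z \<tau>)) \<in> borel_measurable borel"
    by (intro borel_measurable_continuous_on_indicator[OF _ \<sigma>_continuous] borel_closed closed_Times)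
      auto
  from measurable_compose[OF borel_measurable_Pair[OF assms] this] show ?thesis
    by (simp add: indicator_times)
qed

text \<open>The first indicator is redundant, but \<open>\<sigma> z \<tau>\<close> is arbitrary for \<open>\<tau> < 0\<close>, so that \<open>\<sigma>\<close> alone
  need not be measurable.\<close>
definition wave_integrand :: "real^2 \<Rightarrow> real \<Rightarrow> real \<Rightarrow> real" where
  "wave_integrand z r \<tau> = (indicator {0..} \<tau> * \<sigma> z \<tau>) * light_cone_density a t r 0 \<tau>"

lemma indicator_G_kernel_eq:
  "indicator {0..t - norm (y - z) / a} \<tau> *\<^sub>R G_kernel \<sigma> a y z t \<tau>
    = wave_integrand z (norm (y - z)) \<tau>"
  by (auto simp: G_kernel_def wave_integrand_def light_cone_density_def norm_minus_commute
      split: split_indicator)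

lemma abs_wave_integrand_le:
  assumes "0 \<le> r"
  shows "\<bar>wave_integrand z r \<tau>\<bar> \<le> B * light_cone_density a t r 0 \<tau>"
  using \<sigma>_bounded[of \<tau> z] B_nonneg light_cone_density_nonneg[OF a_pos assms]
  by (auto simp: wave_integrand_def abs_mult intro!: mult_right_mono split: split_indicator)

lemma light_cone_density_integral:
  assumes "0 < r" and "r < a * t"
  shows "integrable lborel (light_cone_density a t r 0)"
    and "integral\<^sup>L lborel (light_cone_density a t r 0) = arcosh (a * t / r) / a"
proof -
  have "has_bochner_integral lborel (light_cone_density a t r 0) (arcosh (a * (t - 0) / r) / a)"
    using assms a_pos by (intro has_bochner_integral_light_cone_density) (auto simp: field_simps)
  then show "integrable lborel (light_cone_density a t r 0)"
    "integral\<^sup>L lborel (light_cone_density a t r 0) = arcosh (a * t / r) / a"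
    by (simp_all add: has_bochner_integral_iff)
qed

lemma wave_integrand_integrable:
  assumes "0 < r" and "r < a * t"
  shows "integrable lborel (wave_integrand z r)"
proof (rule Bochner_Integration.integrable_bound)
  show "integrable lborel (\<lambda>\<tau>. B * light_cone_density a t r 0 \<tau>)"
    by (intro integrable_mult_right light_cone_density_integral(1) assms)
  show "AE \<tau> in lborel. norm (wave_integrand z r \<tau>)
      \<le> norm (B * light_cone_density a t r 0 \<tau>)"
    using assms(1) unfolding real_norm_def
    by (intro AE_I2 order_trans[OF abs_wave_integrand_le abs_ge_self]) simp
  show "wave_integrand z r \<in> borel_measurable lborel"
    unfolding wave_integrand_def[abs_def] light_cone_density_def by measurable
qed

lemma G_finite_if_neq: "z \<noteq> y \<Longrightarrow> G_finite \<sigma> a y z t"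
  unfolding G_finite_def set_integrable_def indicator_G_kernel_eq
  using wave_integrand_integrable[of "norm (y - z)" z] by auto

lemma G_fun_eq:
  "G_fun \<sigma> a y z t = (if norm (y - z) < a * t
     then 1 / (2 * pi * a) * integral\<^sup>L lborel (wave_integrand z (norm (y - z))) else 0)"
  unfolding G_fun_def set_lebesgue_integral_def indicator_G_kernel_eq ..

lemma G_fun_measurable [measurable]: "(\<lambda>z. G_fun \<sigma> a y z t) \<in> borel_measurable borel"
proof -
  have [measurable]: "(\<lambda>p. indicator {0..t - norm (y - fst p) / a} (snd p) :: real)
      \<in> borel_measurable (borel \<Otimes>\<^sub>M lborel)"
    unfolding indicator_def atLeastAtMost_iff by measurable
  have "(\<lambda>(z, \<tau>). wave_integrand z (norm (y - z)) \<tau>) \<in> borel_measurable (borel \<Otimes>\<^sub>M lborel)"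
    unfolding wave_integrand_def light_cone_density_def split_beta by measurable
  then have [measurable]:
    "(\<lambda>z. integral\<^sup>L lborel (wave_integrand z (norm (y - z)))) \<in> borel_measurable borel"
    by (rule lborel.borel_measurable_lebesgue_integral)
  show ?thesis unfolding G_fun_eq by measurable
qed

lemma abs_G_fun_le:
  assumes "z \<noteq> y" and "norm (y - z) < a * t"
  shows "\<bar>G_fun \<sigma> a y z t\<bar> \<le> B / (2 * pi * a\<^sup>2) * arcosh (a * t / norm (y - z))"
proof -
  have r: "0 < norm (y - z)" using assms(1) by simp
  let ?w = "light_cone_density a t (norm (y - z)) 0"
  have "\<bar>integral\<^sup>L lborel (wave_integrand z (norm (y - z)))\<bar> \<le> (\<integral>\<tau>. B * ?w \<tau> \<partial>lborel)"
    using wave_integrand_integrable[OF r assms(2)] light_cone_density_integral(1)[OF r assms(2)]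
    by (intro order_trans[OF integral_abs_bound] integral_mono abs_wave_integrand_le) auto
  also have "\<dots> = B * (arcosh (a * t / norm (y - z)) / a)"
    by (simp add: light_cone_density_integral(2)[OF r assms(2)])
  finally show ?thesis
    using assms(2) a_pos by (simp add: G_fun_eq abs_mult power2_eq_square field_simps)
qed

lemma G_fun_square_le:
  assumes "z \<noteq> y"
  shows "(G_fun \<sigma> a y z t)\<^sup>2
    \<le> (B / (2 * pi * a\<^sup>2))\<^sup>2 * (8 * (a * t)) * (norm (y - z) powr -1 * indicator (ball y (a * t)) z)"
proof (cases "norm (y - z) < a * t")
  case True
  let ?u = "a * t / norm (y - z)"
  have "\<bar>G_fun \<sigma> a y z t\<bar>\<^sup>2 \<le> (B / (2 * pi * a\<^sup>2) * arcosh ?u)\<^sup>2"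
    by (intro power_mono abs_G_fun_le assms True) simp
  also have "\<dots> \<le> (B / (2 * pi * a\<^sup>2))\<^sup>2 * (8 * ?u)"
    unfolding power_mult_distrib using assms True
    by (intro mult_left_mono arcosh_square_le) (simp_all add: field_simps)
  also have "\<dots> = (B / (2 * pi * a\<^sup>2))\<^sup>2 * (8 * (a * t)) * norm (y - z) powr -1"
    by (simp add: powr_minus_divide)
  finally show ?thesis using True by (simp add: dist_norm)
qed (use a_pos t_pos in \<open>simp add: G_fun_eq\<close>)

lemma integrable_G_fun_square: "integrable lborel (\<lambda>z. (G_fun \<sigma> a y z t)\<^sup>2)"
proof (rule integrableI_bounded)
  define K where "K = (B / (2 * pi * a\<^sup>2))\<^sup>2 * (8 * (a * t))"
  let ?h = "\<lambda>z. ennreal (norm (y - z) powr -1) * indicator (ball y (a * t)) z"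
  have K: "0 \<le> K" using a_pos t_pos by (simp add: K_def)
  have "ennreal (norm ((G_fun \<sigma> a y z t)\<^sup>2)) \<le> ennreal K * ?h z" if "z \<noteq> y" for z
    using G_fun_square_le[OF that, folded K_def] K
    by (cases "z \<in> ball y (a * t)") (auto simp: ennreal_mult[symmetric] intro!: ennreal_leI)
  moreover have "AE z in lborel. z \<noteq> y" by (rule AE_lborel_singleton)
  ultimately have "(\<integral>\<^sup>+ z. ennreal (norm ((G_fun \<sigma> a y z t)\<^sup>2)) \<partial>lborel)
      \<le> (\<integral>\<^sup>+ z. ennreal K * ?h z \<partial>lborel)"
    by (intro nn_integral_mono_AE) auto
  also have "\<dots> = ennreal K * integral\<^sup>N lborel ?h"
    by (rule nn_integral_cmult)
      (intro borel_measurable_times_ennreal borel_measurable_indicator, auto)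
  also have "\<dots> < \<infinity>"
    using nn_integral_norm_powr_ball_finite[of 1 "a * t" y] a_pos t_pos
    by (simp add: ennreal_mult_less_top)
  finally show "(\<integral>\<^sup>+ z. ennreal (norm ((G_fun \<sigma> a y z t)\<^sup>2)) \<partial>lborel) < \<infinity>" .
qed measurable

text \<open>On \<open>{t - \<eta>..t - r / a}\<close> the two densities agree and the lower bound is \<open>c\<close> times their common
  value; elsewhere the first density vanishes.\<close>
lemma signed_wave_integrand_ge:
  assumes S: "\<bar>S\<bar> = 1" and r: "0 \<le> r" and "\<eta> \<le> t"
    and \<sigma>_ge: "\<And>\<tau>. t - \<eta> \<le> \<tau> \<Longrightarrow> \<tau> \<le> t \<Longrightarrow> c \<le> S * \<sigma> z \<tau>"
  shows "(c + B) * light_cone_density a t r (t - \<eta>) \<tau> - B * light_cone_density a t r 0 \<tau>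
    \<le> S * wave_integrand z r \<tau>"
proof (cases "t - \<eta> \<le> \<tau> \<and> \<tau> \<le> t - r / a")
  case True
  have "r / a \<ge> 0" using a_pos r by simp
  then have "c \<le> S * \<sigma> z \<tau>"
    using True by (intro \<sigma>_ge) linarith+
  then have "c * light_cone_density a t r 0 \<tau> \<le> S * \<sigma> z \<tau> * light_cone_density a t r 0 \<tau>"
    using light_cone_density_nonneg[OF a_pos r] by (rule mult_right_mono)
  moreover have "light_cone_density a t r (t - \<eta>) \<tau> = light_cone_density a t r 0 \<tau>"
    using True assms(3) by (simp add: light_cone_density_def)
  ultimately show ?thesis
    using True assms(3) by (simp add: wave_integrand_def algebra_simps)
next
  case False
  then have "light_cone_density a t r (t - \<eta>) \<tau> = 0"
    by (auto simp: light_cone_density_def)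
  moreover have "\<bar>S * wave_integrand z r \<tau>\<bar> \<le> B * light_cone_density a t r 0 \<tau>"
    using abs_wave_integrand_le[OF r, of z \<tau>] S by (simp add: abs_mult)
  ultimately show ?thesis by simp
qed

lemma abs_G_fun_ge_arcosh:
  assumes S: "\<bar>S\<bar> = 1" and "\<eta> \<le> t"
    and \<sigma>_ge: "\<And>\<tau>. t - \<eta> \<le> \<tau> \<Longrightarrow> \<tau> \<le> t \<Longrightarrow> c \<le> S * \<sigma> z \<tau>"
    and r: "0 < norm (y - z)" "norm (y - z) < a * \<eta>"
  shows "((c + B) * arcosh (a * \<eta> / norm (y - z)) - B * arcosh (a * t / norm (y - z)))
      / (2 * pi * a\<^sup>2) \<le> \<bar>G_fun \<sigma> a y z t\<bar>"
proof -
  let ?r = "norm (y - z)"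
  let ?w = "light_cone_density a t ?r 0" and ?w' = "light_cone_density a t ?r (t - \<eta>)"
  let ?f = "wave_integrand z ?r"
  have "a * \<eta> \<le> a * t" using \<open>\<eta> \<le> t\<close> a_pos by simp
  then have rt: "?r < a * t" using r by linarith
  note w = light_cone_density_integral[OF r(1) rt]
  have "has_bochner_integral lborel ?w' (arcosh (a * (t - (t - \<eta>)) / ?r) / a)"
    using r a_pos by (intro has_bochner_integral_light_cone_density) (auto simp: field_simps)
  then have w': "integrable lborel ?w'" "integral\<^sup>L lborel ?w' = arcosh (a * \<eta> / ?r) / a"
    by (simp_all add: has_bochner_integral_iff)
  have "((c + B) * arcosh (a * \<eta> / ?r) - B * arcosh (a * t / ?r)) / a
      = (\<integral>\<tau>. (c + B) * ?w' \<tau> - B * ?w \<tau> \<partial>lborel)"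
    using w w' by (simp add: diff_divide_distrib)
  also have "\<dots> \<le> (\<integral>\<tau>. S * ?f \<tau> \<partial>lborel)"
    using w(1) w'(1) wave_integrand_integrable[OF r(1) rt]
      signed_wave_integrand_ge[OF S _ assms(2) \<sigma>_ge]
    by (intro integral_mono) auto
  also have "\<dots> \<le> \<bar>integral\<^sup>L lborel ?f\<bar>"
    using abs_ge_self[of "S * integral\<^sup>L lborel ?f"] S by (simp add: abs_mult)
  finally have "((c + B) * arcosh (a * \<eta> / ?r) - B * arcosh (a * t / ?r)) / a / (2 * pi * a)
      \<le> \<bar>integral\<^sup>L lborel ?f\<bar> / (2 * pi * a)"
    using a_pos by (intro divide_right_mono) auto
  then show ?thesis
    using rt a_pos by (simp add: G_fun_eq abs_mult power2_eq_square mult_ac)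
qed

lemma continuous_on_\<sigma>_time: "continuous_on {0..} (\<sigma> z)"
proof -
  have "continuous_on {0..} ((\<lambda>(y, \<tau>). \<sigma> y \<tau>) \<circ> Pair z)"
    by (intro continuous_on_compose continuous_on_subset[OF \<sigma>_continuous] continuous_intros) auto
  then show ?thesis by (simp add: comp_def)
qed

lemma continuous_on_\<sigma>_space: "continuous_on UNIV (\<lambda>z. \<sigma> z t)"
proof -
  have "continuous_on UNIV ((\<lambda>(y, \<tau>). \<sigma> y \<tau>) \<circ> (\<lambda>z. (z, t)))"
    using t_pos
    by (intro continuous_on_compose continuous_on_subset[OF \<sigma>_continuous] continuous_intros) auto
  then show ?thesis by (simp add: comp_def)
qed

lemma \<sigma>_bounded_away_from_zero_before_t:
  assumes "\<sigma> z t \<noteq> 0"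
  obtains S c \<eta> where "\<bar>S\<bar> = 1" "0 < c" "0 < \<eta>" "\<eta> \<le> t"
    "\<And>\<tau>. t - \<eta> \<le> \<tau> \<Longrightarrow> \<tau> \<le> t \<Longrightarrow> c \<le> S * \<sigma> z \<tau>"
proof -
  define S c where "S = sgn (\<sigma> z t)" and "c = \<bar>\<sigma> z t\<bar> / 2"
  have S: "\<bar>S\<bar> = 1" and c: "0 < c" "c < S * \<sigma> z t"
    using assms by (auto simp: S_def c_def sgn_if)
  have "((\<lambda>\<tau>. S * \<sigma> z \<tau>) \<longlongrightarrow> S * \<sigma> z t) (at t within {0..})"
    using continuous_on_\<sigma>_time[of z] t_pos
    by (intro tendsto_mult_left) (simp add: continuous_on_def)
  then have "\<forall>\<^sub>F \<tau> in at t within {0..}. c < S * \<sigma> z \<tau>"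
    using c(2) by (rule order_tendstoD(1))
  then obtain d where d: "0 < d" "\<And>\<tau>. 0 \<le> \<tau> \<Longrightarrow> \<tau> \<noteq> t \<Longrightarrow> dist \<tau> t < d \<Longrightarrow> c < S * \<sigma> z \<tau>"
    by (auto simp: eventually_at)
  show ?thesis
  proof (rule that[OF S c(1), of "min (d / 2) t"])
    show "c \<le> S * \<sigma> z \<tau>" if "t - min (d / 2) t \<le> \<tau>" "\<tau> \<le> t" for \<tau>
      using d c(2) that by (cases "\<tau> = t") (auto simp: dist_real_def intro: less_imp_le)
  qed (use d(1) t_pos in auto)
qed

lemma filterlim_abs_G_fun_at_top:
  assumes "\<sigma> z t \<noteq> 0"
  shows "filterlim (\<lambda>y. \<bar>G_fun \<sigma> a y z t\<bar>) at_top (at z)"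
proof -
  obtain S c \<eta> where S: "\<bar>S\<bar> = 1" and c: "0 < c" and \<eta>: "0 < \<eta>" "\<eta> \<le> t"
    and \<sigma>_ge: "\<And>\<tau>. t - \<eta> \<le> \<tau> \<Longrightarrow> \<tau> \<le> t \<Longrightarrow> c \<le> S * \<sigma> z \<tau>"
    using \<sigma>_bounded_away_from_zero_before_t[OF assms] by metis
  let ?bound = "\<lambda>r. ((c + B) * ln (a * \<eta> / r) - B * ln (2 * (a * t / r))) / (2 * pi * a\<^sup>2)"
  have "filterlim ?bound at_top (at_right 0)"
    using a_pos t_pos c \<eta>(1) by real_asymp
  moreover have "filterlim (\<lambda>y. norm (y - z)) (at_right 0) (at z)"
    by (rule filterlim_at_withinI) (auto intro!: tendsto_eq_intros simp: eventually_at_filter)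
  ultimately have "filterlim (\<lambda>y. ?bound (norm (y - z))) at_top (at z)"
    by (rule filterlim_compose)
  moreover have "?bound (norm (y - z)) \<le> \<bar>G_fun \<sigma> a y z t\<bar>" if "y \<noteq> z" "norm (y - z) < a * \<eta>" for y
  proof -
    let ?r = "norm (y - z)"
    have "a * \<eta> \<le> a * t"
      using \<eta>(2) a_pos by simp
    then have "1 \<le> a * \<eta> / ?r" "1 \<le> a * t / ?r"
      using that by simp_all
    then have "?bound ?r
        \<le> ((c + B) * arcosh (a * \<eta> / ?r) - B * arcosh (a * t / ?r)) / (2 * pi * a\<^sup>2)"
      using c B_nonneg a_pos
      by (intro divide_right_mono diff_mono mult_left_mono ln_le_arcosh arcosh_le_ln_double) auto
    also have "\<dots> \<le> \<bar>G_fun \<sigma> a y z t\<bar>"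
      using that by (intro abs_G_fun_ge_arcosh[OF S \<eta>(2) \<sigma>_ge]) auto
    finally show ?thesis .
  qed
  then have "\<forall>\<^sub>F y in at z. ?bound (norm (y - z)) \<le> \<bar>G_fun \<sigma> a y z t\<bar>"
    unfolding eventually_at using \<eta>(1) a_pos
    by (intro exI[of _ "a * \<eta>"]) (simp add: dist_norm)
  ultimately show ?thesis
    by (rule filterlim_at_top_mono)
qed

lemma open_\<sigma>_nonzero: "open {z. \<sigma> z t \<noteq> 0}"
  by (intro open_Collect_neq continuous_on_\<sigma>_space continuous_on_const)

end

section \<open>Unboundedness\<close>

lemma C_alpha_nonzero:
  assumes "0 < \<alpha>" "\<alpha> < 2"
  shows "C_alpha \<alpha> \<noteq> 0"
proof (cases "\<alpha> = 1")
  case False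
  have "cos (pi * \<alpha> / 2) \<noteq> 0"
  proof (cases "\<alpha> < 1")
    case True
    then have "0 < cos (pi * \<alpha> / 2)" using assms by (intro cos_gt_zero) auto
    then show ?thesis by simp
  next
    case False
    then have "cos (pi * \<alpha> / 2) < cos (pi / 2)"
      using assms \<open>\<alpha> \<noteq> 1\<close> by (intro cos_monotone_0_pi) auto
    then show ?thesis by simp
  qed
  moreover have "0 < Gamma (2 - \<alpha>)" using assms by (intro Gamma_real_pos) simp
  ultimately show ?thesis using False by (simp add: C_alpha_def)
qed (simp add: C_alpha_def)

locale lepage_wave_series = lepage_series M E g \<xi> \<alpha> v \<phi> + wave_kernel a t B \<sigma>
  for M :: "'a measure" and E g \<xi> \<alpha> v \<phi> a t B \<sigma> +
  assumes \<phi>_continuous: "continuous_on UNIV \<phi>"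
begin

abbreviation U :: "real^2 \<Rightarrow> 'a \<Rightarrow> real" where
  "U y \<omega> \<equiv> U_field \<alpha> a \<sigma> \<phi> E \<xi> g y t \<omega>"

definition weighted_kernel :: "real^2 \<Rightarrow> real^2 \<Rightarrow> real" where
  "weighted_kernel y z = \<phi> z powr (-1 / \<alpha>) * G_fun \<sigma> a y z t"

lemma \<phi>_measurable [measurable]: "\<phi> \<in> borel_measurable borel"
  using \<phi>_continuous by (rule borel_measurable_continuous_onI)

lemma weighted_kernel_measurable [measurable]: "weighted_kernel y \<in> borel_measurable borel"
  unfolding weighted_kernel_def[abs_def] by measurable

lemma integrable_weighted_kernel_square: "integrable lborel (\<lambda>z. \<phi> z * (weighted_kernel y z)\<^sup>2)"
proof -
  let ?h = "\<lambda>z. \<phi> z * (\<phi> z powr (-1 / \<alpha>))\<^sup>2"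
  have "continuous_on (cball y (a * t)) ?h"
    using \<phi>_pos
    by (intro continuous_intros continuous_on_subset[OF \<phi>_continuous])
      (auto simp: less_imp_neq[symmetric])
  then have "bounded (?h ` cball y (a * t))"
    by (intro compact_imp_bounded compact_continuous_image) auto
  then obtain K where K: "\<forall>z\<in>cball y (a * t). \<bar>?h z\<bar> \<le> K"
    by (auto simp: bounded_iff)
  show ?thesis
  proof (rule Bochner_Integration.integrable_bound)
    show "integrable lborel (\<lambda>z. K * (G_fun \<sigma> a y z t)\<^sup>2)"
      by (intro integrable_mult_right integrable_G_fun_square)
    have "\<bar>?h z\<bar> * (G_fun \<sigma> a y z t)\<^sup>2 \<le> K * (G_fun \<sigma> a y z t)\<^sup>2" for z
      using K
      by (cases "norm (y - z) < a * t") (auto simp: dist_norm G_fun_def intro!: mult_right_mono)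
    moreover have "norm (\<phi> z * (weighted_kernel y z)\<^sup>2) = \<bar>?h z\<bar> * (G_fun \<sigma> a y z t)\<^sup>2" for z
      by (simp add: weighted_kernel_def power_mult_distrib abs_mult mult.assoc)
    ultimately show "AE z in lborel.
        norm (\<phi> z * (weighted_kernel y z)\<^sup>2) \<le> norm (K * (G_fun \<sigma> a y z t)\<^sup>2)"
      by (intro AE_I2) (metis abs_ge_self order_trans real_norm_def)
  qed measurable
qed

definition lepage_coefficient :: "nat \<Rightarrow> real^2 \<Rightarrow> 'a \<Rightarrow> real" where
  "lepage_coefficient k y \<omega> = C_alpha \<alpha> * arrival E k \<omega> powr (-1 / \<alpha>) * weighted_kernel y (\<xi> k \<omega>)"

lemma lepage_term_eq: "lepage_term \<alpha> a \<sigma> \<phi> E \<xi> g y t \<omega> = (\<lambda>k. lepage_coefficient k y \<omega> * g k \<omega>)"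
  by (simp add: fun_eq_iff lepage_term_def lepage_coefficient_def weighted_kernel_def)

lemma AE_U_defined: "AE \<omega> in M. U_defined \<alpha> a \<sigma> \<phi> E \<xi> g y t \<omega>"
proof -
  have "AE \<omega> in M. summable (\<lambda>k. arrival E k \<omega> powr (-1 / \<alpha>) * weighted_kernel y (\<xi> k \<omega>) * g k \<omega>)"
    by (intro AE_summable_weighted_arrivals integrable_weighted_kernel_square) measurable
  moreover have "AE \<omega> in M. \<forall>k. \<xi> k \<omega> \<noteq> y"
    using AE_neq_if_distributed_lborel[OF \<xi>_distributed] by (simp add: AE_all_countable)
  ultimately show ?thesis
  proof eventually_elim
    case (elim \<omega>)
    have "summable (\<lambda>k. lepage_coefficient k y \<omega> * g k \<omega>)"
      using summable_mult[OF elim(1), of "C_alpha \<alpha>"]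
      by (simp only: lepage_coefficient_def mult.assoc)
    then show ?case
      using elim(2) by (simp add: U_defined_def G_finite_if_neq lepage_term_eq)
  qed
qed

definition lepage_remainder :: "nat \<Rightarrow> real^2 \<Rightarrow> 'a \<Rightarrow> real" where
  "lepage_remainder k y \<omega> = (\<Sum>j. if j = k then 0 else lepage_coefficient j y \<omega> * g j \<omega>)"

lemma U_eq:
  assumes "U_defined \<alpha> a \<sigma> \<phi> E \<xi> g y t \<omega>"
  shows "U y \<omega> = lepage_coefficient k y \<omega> * g k \<omega> + lepage_remainder k y \<omega>"
proof -
  let ?f = "\<lambda>j. lepage_coefficient j y \<omega> * g j \<omega>"
  have "?f sums U y \<omega>"
    using assms by (simp add: U_defined_def U_field_def lepage_term_eq summable_sums)
  then have "(\<lambda>j. ?f j - (if j = k then ?f j else 0)) sums (U y \<omega> - ?f k)"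
    by (intro sums_diff sums_single)
  moreover have "(\<lambda>j. ?f j - (if j = k then ?f j else 0)) = (\<lambda>j. if j = k then 0 else ?f j)"
    by auto
  ultimately show ?thesis
    by (simp add: lepage_remainder_def sums_iff)
qed

lemma lepage_coefficient_measurable_except_g [measurable]:
  "lepage_coefficient j y \<in> borel_measurable (algebra_except_g k)"
  unfolding lepage_coefficient_def[abs_def] arrival_def by measurable

lemma lepage_remainder_measurable_except_g [measurable]:
  "lepage_remainder k y \<in> borel_measurable (algebra_except_g k)"
proof -
  have "(\<lambda>\<omega>. if j = k then 0 else lepage_coefficient j y \<omega> * g j \<omega>)
      \<in> borel_measurable (algebra_except_g k)" for j
    using g_measurable_except_g[of j k] by (cases "j = k") (auto intro: borel_measurable_times)
  then show ?thesis
    unfolding lepage_remainder_def[abs_def] by measurable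
qed

lemma AE_bounded_U_imp_bounded_lepage_coefficient:
  assumes "countable D"
  shows "AE \<omega> in M. bounded ((\<lambda>y. U y \<omega>) ` D) \<longrightarrow>
    (\<forall>k. bounded ((\<lambda>y. lepage_coefficient k y \<omega>) ` D))"
proof -
  have "AE \<omega> in M. \<forall>k.
      bounded ((\<lambda>y. lepage_coefficient k y \<omega> * g k \<omega> + lepage_remainder k y \<omega>) ` D) \<longrightarrow>
      bounded ((\<lambda>y. lepage_coefficient k y \<omega>) ` D)"
    unfolding AE_all_countable
    by (intro allI AE_bounded_affine_imp_bounded[OF indep_of_algebra_except_g g_atomless assms])
      measurable
  moreover have "AE \<omega> in M. \<forall>y\<in>D. U_defined \<alpha> a \<sigma> \<phi> E \<xi> g y t \<omega>"
    by (rule AE_ball_countable'[OF AE_U_defined assms])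
  ultimately show ?thesis
  proof eventually_elim
    case (elim \<omega>)
    have "(\<lambda>y. U y \<omega>) ` D =
        (\<lambda>y. lepage_coefficient k y \<omega> * g k \<omega> + lepage_remainder k y \<omega>) ` D" for k
      using elim(2) U_eq by (intro image_cong) auto
    then show ?case using elim(1) by simp
  qed
qed

lemma not_bounded_lepage_coefficient:
  assumes "0 < arrival E k \<omega>" and "\<sigma> (\<xi> k \<omega>) t \<noteq> 0" and "\<xi> k \<omega> islimpt D"
  shows "\<not> bounded ((\<lambda>y. lepage_coefficient k y \<omega>) ` D)"
proof (rule not_bounded_image_if_filterlim_at_top[OF _ assms(3)])
  let ?c = "C_alpha \<alpha> * arrival E k \<omega> powr (-1 / \<alpha>) * \<phi> (\<xi> k \<omega>) powr (-1 / \<alpha>)"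
  have "0 < \<bar>?c\<bar>"
    using C_alpha_nonzero[OF \<alpha>_pos \<alpha>_less_2] assms(1) \<phi>_pos[of "\<xi> k \<omega>"] by simp
  then have "filterlim (\<lambda>y. \<bar>?c\<bar> * \<bar>G_fun \<sigma> a y (\<xi> k \<omega>) t\<bar>) at_top (at (\<xi> k \<omega>))"
    by (rule filterlim_tendsto_pos_mult_at_top[OF tendsto_const _
          filterlim_abs_G_fun_at_top[OF assms(2)]])
  then show "filterlim (\<lambda>y. \<bar>lepage_coefficient k y \<omega>\<bar>) at_top (at (\<xi> k \<omega>))"
    by (simp add: lepage_coefficient_def weighted_kernel_def abs_mult mult.assoc)
qed

lemma AE_\<xi>_hits_open:
  assumes "open S" "S \<noteq> {}"
  shows "AE \<omega> in M. \<exists>k. \<xi> k \<omega> \<in> S"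
proof (rule AE_ex_in_if_indep_vars[OF indep_vars_\<xi>])
  have "prob (\<xi> k -` S \<inter> space M) = prob (\<xi> 0 -` S \<inter> space M)" for k
    using assms(1) by (simp add: measure_def distributed_emeasure[OF \<xi>_distributed])
  then show "prob (\<xi> 0 -` S \<inter> space M) \<le> prob (\<xi> k -` S \<inter> space M)" for k
    by (rule eq_refl[OF sym])
  show "0 < prob (\<xi> 0 -` S \<inter> space M)"
    using \<phi>_pos by (intro prob_pos_if_distributed_pos_density[OF \<xi>_distributed] assms) simp
qed (use assms(1) in simp)

lemma AE_not_bounded_U:
  assumes "countable D" and S: "open S" "S \<noteq> {}"
    and "\<And>z. z \<in> S \<Longrightarrow> z islimpt D" "\<And>z. z \<in> S \<Longrightarrow> \<sigma> z t \<noteq> 0"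
  shows "AE \<omega> in M. \<not> bounded ((\<lambda>y. U y \<omega>) ` D)"
  using AE_bounded_U_imp_bounded_lepage_coefficient[OF assms(1)] AE_\<xi>_hits_open[OF S]
    AE_arrival_pos
proof eventually_elim
  case (elim \<omega>)
  then obtain k where "\<xi> k \<omega> \<in> S" by blast
  then have "\<not> bounded ((\<lambda>y. lepage_coefficient k y \<omega>) ` D)"
    using elim(3) assms(4,5) by (intro not_bounded_lepage_coefficient) auto
  then show ?case using elim(1) by blast
qed

lemma AE_SUP_abs_U_eq_PInfty:
  assumes x: "\<sigma> x t \<noteq> 0" and \<delta>: "0 < \<delta>"
  shows "AE \<omega> in M. (SUP y \<in> {y. dist y x \<le> \<delta> \<and> U_defined \<alpha> a \<sigma> \<phi> E \<xi> g y t \<omega>}.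
    ereal \<bar>U y \<omega>\<bar>) = \<infinity>"
proof -
  obtain D :: "(real^2) set" where D: "countable D" "\<And>X. open X \<Longrightarrow> X \<noteq> {} \<Longrightarrow> \<exists>d\<in>D. d \<in> X"
    using countable_dense_setE by blast
  let ?D = "D \<inter> ball x \<delta>" and ?S = "{z. \<sigma> z t \<noteq> 0} \<inter> ball x \<delta>"
  have "AE \<omega> in M. \<not> bounded ((\<lambda>y. U y \<omega>) ` ?D)"
  proof (rule AE_not_bounded_U)
    show "z islimpt ?D" if "z \<in> ?S" for z
      using that by (intro islimpt_dense_Int_open D(2)) auto
    show "?S \<noteq> {}" using x \<delta> by auto
    show "open ?S" by (intro open_Int open_\<sigma>_nonzero open_ball)
  qed (use D(1) in auto)
  moreover have "AE \<omega> in M. \<forall>y\<in>?D. U_defined \<alpha> a \<sigma> \<phi> E \<xi> g y t \<omega>"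
    using D(1) by (intro AE_ball_countable'[OF AE_U_defined]) auto
  ultimately show ?thesis
  proof eventually_elim
    case (elim \<omega>)
    show ?case
      using elim(2) by (intro SUP_ereal_abs_eq_PInfty[OF elim(1)]) (auto simp: dist_commute)
  qed
qed

end

theorem theorem2:
  fixes M :: "'a measure" and \<alpha> a t \<delta> :: real
    and \<sigma> :: "real^2 \<Rightarrow> real \<Rightarrow> real" and \<phi> :: "real^2 \<Rightarrow> real"
    and E g :: "nat \<Rightarrow> 'a \<Rightarrow> real" and \<xi> :: "nat \<Rightarrow> 'a \<Rightarrow> real^2" and x :: "real^2"
  assumes "prob_space M"
    and "0 < \<alpha>" "\<alpha> < 2" "0 < a"
    and "continuous_on (UNIV \<times> {0..}) (\<lambda>(y, \<tau>). \<sigma> y \<tau>)"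
    and "\<exists>B. \<forall>y \<tau>. 0 \<le> \<tau> \<longrightarrow> \<bar>\<sigma> y \<tau>\<bar> \<le> B"
    and "continuous_on UNIV \<phi>" "\<forall>z. 0 < \<phi> z" "(\<integral>\<^sup>+ z. ennreal (\<phi> z) \<partial>lborel) = 1"
    and "\<forall>i. distributed M lborel (E i) (\<lambda>s. ennreal (exponential_density 1 s))"
    and "\<forall>k. distributed M lborel (\<xi> k) (\<lambda>z. ennreal (\<phi> z))"
    and "\<exists>s>0. \<forall>k. distributed M lborel (g k) (\<lambda>r. ennreal (normal_density 0 s r))"
    and "\<forall>k. prob_space.expectation M (\<lambda>\<omega>. \<bar>g k \<omega>\<bar> powr \<alpha>) = 1"
    and "lepage_indep M E \<xi> g"
    and "0 < t" and "\<sigma> x t \<noteq> 0" and "0 < \<delta>"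
  shows "AE \<omega> in M.
    (SUP y \<in> {y. dist y x \<le> \<delta> \<and> U_defined \<alpha> a \<sigma> \<phi> E \<xi> g y t \<omega>}.
       ereal \<bar>U_field \<alpha> a \<sigma> \<phi> E \<xi> g y t \<omega>\<bar>) = \<infinity>"
proof -
  interpret prob_space M by fact
  obtain B where B: "\<And>y \<tau>. 0 \<le> \<tau> \<Longrightarrow> \<bar>\<sigma> y \<tau>\<bar> \<le> B" using assms(6) by blast
  obtain s where s: "0 < s" and g: "\<And>k. distributed M lborel (g k) (normal_density 0 s)"
    using assms(12) by blast
  note g_moments = normal_distributed_expectation[OF s g] centred_normal_second_moment[OF g s]
  interpret lepage_wave_series M E g \<xi> \<alpha> "s\<^sup>2" \<phi> a t B \<sigma>
  proof unfold_locales
    show "random_variable borel (E n)" "random_variable borel (\<xi> n)"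
      "random_variable borel (g n)" for n
      using assms(10,11) g[of n] by (auto dest!: distributed_measurable spec[of _ n])
    show "AE \<omega> in M. g k \<omega> \<noteq> u" for k u
      by (rule AE_neq_if_distributed_lborel[OF g])
  qed (use assms B g_moments in auto)
  show ?thesis
    by (rule AE_SUP_abs_U_eq_PInfty) fact+
qed

end
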